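(* Let $\theta\in(0,1)$ be irrational and let $\Xi$ be the (one-sided) Sturmian subshift associated with $\theta$. Let $(\delta_n)_{n\ge 0}$ be a strictly decreasing sequence of positive reals converging to $0$ for which there are constants $\underline{c},\overline{c}>0$ with $\underline{c}\,\delta_n\le \delta_{2n}$ and $\delta_{nm}\le \overline{c}\,\delta_n\delta_m$ for all $n,m\ge 1$; equip $\Xi$ with the metric $d$ defined by $(\delta_n)_n$. Then the following are equivalent: (i) the Sturmian subshift is linearly recurrent; (ii) the continued fraction expansion of $\theta$ is bounded (i.e. has bounded partial quotients); (iii) $\overline{d}_s$ is Lipschitz equivalent to $d$.
   Context: Sturmian subshift of $\theta$. Let $E_0\subset\mathbb R^2$ be a line parallel to $(1,\theta)$ not meeting $\mathbb Z^2$. The points of $(E_0+[0,1]^2)\cap\mathbb Z^2$, ordered along the direction $(1,\theta)$, form a staircase in which consecutive points differ by $(1,0)$ or $(0,1)$; writing $a$ for a step $(1,0)$ and $b$ for a step $(0,1)$ gives a bi-infinite word in $\{a,b\}$. Its set of finite words $\mathcal L$ (including the empty word) depends only on $\theta$, and the Sturmian subshift $\Xi$ is the set of one-sided infinite sequences $\xi=\xi_1\xi_2\cdots$ all of whose finite subwords lie in $\mathcal L$. It is linearly recurrent if there is $C>0$ such that, for all $n\ge1$, every word of $\mathcal L$ of length at least $Cn$ contains every word of $\mathcal L$ of length $n$. Metric. For $\xi\ne\eta$ in $\Xi$, $d(\xi,\eta)=\delta_n$ where $n$ is the length of the longest common prefix of $\xi$ and $\eta$, and $d(\xi,\xi)=0$.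 Choice functions. A choice function $\tau$ is given by choosing, for each $w\in\mathcal L$, a letter $a_w$ with $wa_w\in\mathcal L$; $\tau(w)\in\Xi$ is the infinite sequence obtained from $w$ by recursively appending the chosen letters. Spectral distance. Let $E$ be the set of ordered pairs $e=(u,v)$ of distinct words of $\mathcal L$ of equal length $n+1\ge1$ having the same prefix of length $n$; the length of such an edge is $l(e)=\delta_n$. On $\ell^2(E)$ let $\pi_\tau(f)\psi(u,v)=f(\tau(u))\psi(u,v)$ for $f\in C(\Xi)$, and $D\psi(u,v)=l(u,v)^{-1}\psi(v,u)$. The spectral distance is $d_s^\tau(x,y)=\sup\{|f(x)-f(y)|: f\in C(\Xi),\ \|[D,\pi_\tau(f)]\|\le 1\}\in[0,\infty]$; the condition $\|[D,\pi_\tau(f)]\|\le1$ means $|f(\tau(u))-f(\tau(v))|\le l(u,v)$ for all $(u,v)\in E$. Put $\overline{d}_s=\sup_\tau d_s^\tau$, the supremum over all choice functions. $\overline d_s$ is Lipschitz equivalent to $d$ if there is $c>0$ with $c^{-1}d\le \overline d_s\le c\,d$. *)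

theory Defs
  imports "HOL-Analysis.Analysis" "HOL-Library.Sublist"
begin

section \<open>The Sturmian subshift\<close>

datatype letter = LetterA | LetterB

definition lattice_point :: "int \<times> int \<Rightarrow> real \<times> real" where
  "lattice_point z = (real_of_int (fst z), real_of_int (snd z))"

definition line_of_slope :: "real \<Rightarrow> (real \<times> real) set \<Rightarrow> bool" where
  "line_of_slope \<theta> E0 \<longleftrightarrow> (\<exists>q. E0 = range (\<lambda>t. q + t *\<^sub>R (1, \<theta>)))"

definition strip_points :: "(real \<times> real) set \<Rightarrow> (int \<times> int) set" where
  "strip_points E0 =
     {z. \<exists>e\<in>E0. \<exists>s\<in>{0..1}. \<exists>t\<in>{0..1}. lattice_point z = e + (s, t)}"

definition staircase :: "real \<Rightarrow> (real \<times> real) set \<Rightarrow> (int \<Rightarrow> int \<times> int) \<Rightarrow> bool" where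
  "staircase \<theta> E0 p \<longleftrightarrow>
     range p = strip_points E0 \<and> strict_mono (\<lambda>i. lattice_point (p i) \<bullet> (1, \<theta>))"

text \<open>Consecutive points of a staircase differ by \<open>(1, 0)\<close> or \<open>(0, 1)\<close>,
  so the \<open>else\<close> branch is the step \<open>(0, 1)\<close>.\<close>

definition step_word :: "(int \<Rightarrow> int \<times> int) \<Rightarrow> int \<Rightarrow> letter" where
  "step_word p i = (if p (i + 1) = p i + (1, 0) then LetterA else LetterB)"

text \<open>All lines that miss the lattice yield the same finite words, so the union over these
  lines is the language of any one of them.\<close>

definition sturmian_language :: "real \<Rightarrow> letter list set" where
  "sturmian_language \<theta> =
     {w. \<exists>E0 p k. line_of_slope \<theta> E0 \<and> E0 \<inter> range lattice_point = {} \<and> staircase \<theta> E0 p \<and>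
           w = map (\<lambda>j. step_word p (k + int j)) [0..<length w]}"

text \<open>One-sided sequences are indexed from \<open>0\<close>: \<open>\<xi> i\<close> is the letter in position \<open>i + 1\<close>.\<close>

definition sturmian_subshift :: "real \<Rightarrow> (nat \<Rightarrow> letter) set" where
  "sturmian_subshift \<theta> = {\<xi>. \<forall>i n. map \<xi> [i..<i + n] \<in> sturmian_language \<theta>}"

definition linearly_recurrent :: "letter list set \<Rightarrow> bool" where
  "linearly_recurrent L \<longleftrightarrow>
     (\<exists>C::real. C > 0 \<and> (\<forall>n\<ge>1. \<forall>w\<in>L. C * real n \<le> real (length w) \<longrightarrow>
        (\<forall>v\<in>L. length v = n \<longrightarrow> sublist v w)))"


section \<open>Continued fractions\<close>

text \<open>For irrational \<open>x\<close> the fractional parts below never vanish.\<close>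

fun partial_quotient :: "real \<Rightarrow> nat \<Rightarrow> int" where
  "partial_quotient x 0 = \<lfloor>x\<rfloor>"
| "partial_quotient x (Suc k) = partial_quotient (1 / frac x) k"

definition bounded_partial_quotients :: "real \<Rightarrow> bool" where
  "bounded_partial_quotients x \<longleftrightarrow> (\<exists>M. \<forall>k. partial_quotient x k \<le> M)"


section \<open>The metric\<close>

definition common_prefix_length :: "(nat \<Rightarrow> letter) \<Rightarrow> (nat \<Rightarrow> letter) \<Rightarrow> nat" where
  "common_prefix_length \<xi> \<eta> = (GREATEST n. \<forall>i<n. \<xi> i = \<eta> i)"

definition word_dist :: "(nat \<Rightarrow> real) \<Rightarrow> (nat \<Rightarrow> letter) \<Rightarrow> (nat \<Rightarrow> letter) \<Rightarrow> real" where
  "word_dist \<delta> \<xi> \<eta> = (if \<xi> = \<eta> then 0 else \<delta> (common_prefix_length \<xi> \<eta>))"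

lemma common_prefix_length_less_iff:
  assumes "x \<noteq> y"
  shows "n \<le> common_prefix_length x y \<longleftrightarrow> (\<forall>i<n. x i = y i)"
proof -
  obtain k where k: "x k \<noteq> y k" using assms by auto
  have b: "m \<le> k" if "\<forall>i<m. x i = y i" for m
    using that k by (meson not_le_imp_less)
  have "\<forall>i<common_prefix_length x y. x i = y i"
    unfolding common_prefix_length_def
    by (rule GreatestI_nat[where k = 0 and b = k]) (use b in auto)
  moreover have "m \<le> common_prefix_length x y" if "\<forall>i<m. x i = y i" for m
    unfolding common_prefix_length_def
    by (rule Greatest_le_nat[where b = k]) (use b that in auto)
  ultimately show ?thesis by auto
qed

lemma Metric_space_word_dist:
  assumes pos: "\<And>n. 0 < \<delta> n" and dec: "\<And>m n. m < n \<Longrightarrow> \<delta> n < \<delta> m"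
  shows "Metric_space X (word_dist \<delta>)"
proof
  note le = common_prefix_length_less_iff
  have mono: "\<delta> n \<le> \<delta> m" if "m \<le> n" for m n
    using dec[of m n] that by (cases "m = n") auto
  show "0 \<le> word_dist \<delta> x y" for x y
    using pos by (simp add: word_dist_def less_imp_le)
  show "word_dist \<delta> x y = word_dist \<delta> y x" for x y
    by (simp add: word_dist_def common_prefix_length_def eq_commute)
  show "word_dist \<delta> x y = 0 \<longleftrightarrow> x = y" for x y
    using pos[of "common_prefix_length x y"] by (simp add: word_dist_def)
  show "word_dist \<delta> x z \<le> word_dist \<delta> x y + word_dist \<delta> y z" for x y z
  proof (cases "x = y \<or> y = z \<or> x = z")
    case True
    then show ?thesis using pos by (auto simp: word_dist_def less_imp_le add_nonneg_nonneg)
  next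
    case False
    let ?m = "min (common_prefix_length x y) (common_prefix_length y z)"
    have "?m \<le> common_prefix_length x z"
      using False le[of x y ?m] le[of y z ?m] le[of x z ?m] by auto
    then have "\<delta> (common_prefix_length x z) \<le> \<delta> ?m" by (rule mono)
    also have "\<dots> \<le> \<delta> (common_prefix_length x y) + \<delta> (common_prefix_length y z)"
      using pos[of "common_prefix_length x y"] pos[of "common_prefix_length y z"] by (simp add: min_def)
    finally show ?thesis using False by (simp add: word_dist_def)
  qed
qed

definition continuous_functions ::
    "(nat \<Rightarrow> real) \<Rightarrow> (nat \<Rightarrow> letter) set \<Rightarrow> ((nat \<Rightarrow> letter) \<Rightarrow> complex) set" where
  "continuous_functions \<delta> X =
     {f. continuous_map (Metric_space.mtopology X (word_dist \<delta>)) euclidean f}"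


section \<open>Choice functions\<close>

definition choice_functions :: "letter list set \<Rightarrow> (letter list \<Rightarrow> letter) set" where
  "choice_functions L = {c. \<forall>w\<in>L. w @ [c w] \<in> L}"

definition extend_by :: "(letter list \<Rightarrow> letter) \<Rightarrow> nat \<Rightarrow> letter list \<Rightarrow> letter list" where
  "extend_by c n = (\<lambda>w. w @ [c w]) ^^ n"

text \<open>The word \<open>extend_by c (Suc i) w\<close> has length at least \<open>i + 1\<close>, and appending further
  letters does not change its entry with index \<open>i\<close>.\<close>

definition choice_seq :: "(letter list \<Rightarrow> letter) \<Rightarrow> letter list \<Rightarrow> nat \<Rightarrow> letter" where
  "choice_seq c w i = extend_by c (Suc i) w ! i"


section \<open>The spectral triple and the spectral distance\<close>

type_synonym edge = "letter list \<times> letter list"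

definition edges :: "letter list set \<Rightarrow> edge set" where
  "edges L = {(u, v). u \<in> L \<and> v \<in> L \<and> u \<noteq> v \<and>
     (\<exists>n. length u = n + 1 \<and> length v = n + 1 \<and> take n u = take n v)}"

definition edge_length :: "(nat \<Rightarrow> real) \<Rightarrow> edge \<Rightarrow> real" where
  "edge_length \<delta> e = \<delta> (length (fst e) - 1)"

definition ell2 :: "edge set \<Rightarrow> (edge \<Rightarrow> complex) set" where
  "ell2 E = {\<psi>. (\<forall>e. e \<notin> E \<longrightarrow> \<psi> e = 0) \<and> (\<lambda>e. (cmod (\<psi> e))\<^sup>2) summable_on E}"

definition ell2_norm :: "edge set \<Rightarrow> (edge \<Rightarrow> complex) \<Rightarrow> real" where
  "ell2_norm E \<psi> = sqrt (\<Sum>\<^sub>\<infinity>e\<in>E. (cmod (\<psi> e))\<^sup>2)"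

definition rep_op :: "(letter list \<Rightarrow> letter) \<Rightarrow> ((nat \<Rightarrow> letter) \<Rightarrow> complex) \<Rightarrow>
    (edge \<Rightarrow> complex) \<Rightarrow> edge \<Rightarrow> complex" where
  "rep_op c f \<psi> = (\<lambda>(u, v). f (choice_seq c u) * \<psi> (u, v))"

definition dirac_op :: "(nat \<Rightarrow> real) \<Rightarrow> (edge \<Rightarrow> complex) \<Rightarrow> edge \<Rightarrow> complex" where
  "dirac_op \<delta> \<psi> = (\<lambda>(u, v). \<psi> (v, u) / of_real (edge_length \<delta> (u, v)))"

definition dirac_domain :: "(nat \<Rightarrow> real) \<Rightarrow> edge set \<Rightarrow> (edge \<Rightarrow> complex) set" where
  "dirac_domain \<delta> E = {\<psi> \<in> ell2 E. dirac_op \<delta> \<psi> \<in> ell2 E}"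

definition commutator :: "(nat \<Rightarrow> real) \<Rightarrow> (letter list \<Rightarrow> letter) \<Rightarrow>
    ((nat \<Rightarrow> letter) \<Rightarrow> complex) \<Rightarrow> (edge \<Rightarrow> complex) \<Rightarrow> edge \<Rightarrow> complex" where
  "commutator \<delta> c f \<psi> =
     (\<lambda>e. dirac_op \<delta> (rep_op c f \<psi>) e - rep_op c f (dirac_op \<delta> \<psi>) e)"

text \<open>The Dirac operator is unbounded, so the commutator is taken on its (dense) natural
  domain.  Membership in \<open>ell2\<close> is required separately because \<open>ell2_norm\<close> is \<open>0\<close> on functions
  that are not square summable.\<close>

definition commutator_norm_le_1 :: "(nat \<Rightarrow> real) \<Rightarrow> edge set \<Rightarrow>
    (letter list \<Rightarrow> letter) \<Rightarrow> ((nat \<Rightarrow> letter) \<Rightarrow> complex) \<Rightarrow> bool" where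
  "commutator_norm_le_1 \<delta> E c f \<longleftrightarrow>
     (\<forall>\<psi>\<in>dirac_domain \<delta> E. commutator \<delta> c f \<psi> \<in> ell2 E \<and>
        ell2_norm E (commutator \<delta> c f \<psi>) \<le> ell2_norm E \<psi>)"

definition spectral_dist :: "real \<Rightarrow> (nat \<Rightarrow> real) \<Rightarrow> (letter list \<Rightarrow> letter) \<Rightarrow>
    (nat \<Rightarrow> letter) \<Rightarrow> (nat \<Rightarrow> letter) \<Rightarrow> ennreal" where
  "spectral_dist \<theta> \<delta> c x y =
     (SUP f \<in> {f \<in> continuous_functions \<delta> (sturmian_subshift \<theta>).
                 commutator_norm_le_1 \<delta> (edges (sturmian_language \<theta>)) c f}.
        ennreal (cmod (f x - f y)))"

definition spectral_dist_sup :: "real \<Rightarrow> (nat \<Rightarrow> real) \<Rightarrow>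
    (nat \<Rightarrow> letter) \<Rightarrow> (nat \<Rightarrow> letter) \<Rightarrow> ennreal" where
  "spectral_dist_sup \<theta> \<delta> x y =
     (SUP c \<in> choice_functions (sturmian_language \<theta>). spectral_dist \<theta> \<delta> c x y)"

definition lipschitz_equivalent ::
    "'a set \<Rightarrow> ('a \<Rightarrow> 'a \<Rightarrow> ennreal) \<Rightarrow> ('a \<Rightarrow> 'a \<Rightarrow> real) \<Rightarrow> bool" where
  "lipschitz_equivalent X D d \<longleftrightarrow>
     (\<exists>c::real. c > 0 \<and> (\<forall>x\<in>X. \<forall>y\<in>X.
        ennreal (inverse c * d x y) \<le> D x y \<and> D x y \<le> ennreal (c * d x y)))"

end

theory Submission
  imports Defs
begin

text \<open>
  With \<open>\<alpha> = \<theta> / (1 + \<theta>)\<close>, the words of the language code the orbits of the rotation by \<open>\<alpha>\<close>, and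
  \<open>\<theta>\<close> has bounded partial quotients iff \<open>\<alpha>\<close> is badly approximable, \<open>i * \<bar>i * \<alpha> - j\<bar> \<ge> c > 0\<close>.
  If so, the cylinders of length \<open>n\<close> have length comparable to \<open>1 / n\<close>, which gives linear
  recurrence, and two right special prefixes of lengths \<open>n < n'\<close> of one sequence satisfy
  \<open>n' - n \<ge> \<epsilon> * n\<close>.  If not, the language contains arbitrarily high powers, which contradicts
  linear recurrence because the sequences are not periodic.

  For \<open>x \<noteq> y\<close> with common prefix of length \<open>m\<close>, a test function changes along the prefixes of \<open>x\<close>
  only at the right special ones, by at most \<open>\<delta> n\<close> at length \<open>n\<close>, and a suitable choice function
  realises any finite set of these jumps.  So the supremum of the spectral distances is
  comparable to \<open>\<delta> m\<close> iff the sums of \<open>\<delta> n\<close> over the right special prefixes longer than \<open>m\<close> are: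
  these sums are geometric when the lengths are lacunary, and a high power in the language
  contributes many terms of size about \<open>\<delta> m\<close>.
\<close>

section \<open>Continued fractions and badly approximable numbers\<close>

text \<open>The height of a lattice point above the line drops by \<theta> along a step
  \<open>(1, 0)\<close> and grows by 1 along \<open>(0, 1)\<close>. Divided by
  \<open>1 + \<theta>\<close>, these changes are \<open>- \<alpha>\<close> and
  \<open>1 - \<alpha>\<close>, equal modulo 1, which is why one rotation governs both letters.
  Cylinders then end at points \<open>k - j * \<alpha>\<close>, so the language is controlled by the
  distances of \<open>i * \<alpha>\<close> to integers: bad approximability bounds cylinders below
  directly and, through a Dirichlet denominator, above.

  The supremum over choice functions matters because a test function cannot jump at a prefix of
  \<open>x\<close> where the choice function itself continues along \<open>x\<close>.

  The two growth conditions on \<delta> serve opposite directions. The product bound lets \<delta>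
  halve whenever the length is multiplied by one fixed factor, so a lacunary sum is dominated by its
  first scale. The doubling bound makes all \<delta> between lengths \<open>m\<close> and
  \<open>2 * m\<close> comparable, so sufficiently many such terms exceed any proposed Lipschitz
  constant.\<close>

definition badly_approximable :: "real \<Rightarrow> bool" where
  "badly_approximable \<alpha> \<longleftrightarrow>
     (\<exists>c>0. \<forall>i::nat. i \<ge> 1 \<longrightarrow> (\<forall>j::int. c / real i \<le> \<bar>real i * \<alpha> - of_int j\<bar>))"

text \<open>This ratio is invariant under a Gauss step applied to \<open>x\<close> and \<open>y\<close> at once, so it links approximations of \<open>x\<close>
  to the later complete quotients without convergents: at \<open>p = 1\<close>, \<open>q = 0\<close> it is \<open>1 / (x - y)\<close>.\<close>

definition cf_form :: "real \<Rightarrow> real \<Rightarrow> real \<Rightarrow> real \<Rightarrow> real" where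
  "cf_form x y p q = \<bar>p - q * x\<bar> * (p - q * y) / (x - y)"

lemma irrational_frac:
  fixes x :: real
  assumes "x \<notin> \<rat>"
  shows "0 < frac x" and "frac x < 1" and "1 / frac x \<notin> \<rat>" and "1 < 1 / frac x"
proof -
  show *: "0 < frac x" using assms by (metis Ints_subset_Rats frac_gt_0_iff subsetD)
  show "frac x < 1" by (rule frac_lt_1)
  then show "1 < 1 / frac x" using * by simp
  show "1 / frac x \<notin> \<rat>"
  proof
    assume "1 / frac x \<in> \<rat>"
    then have "1 / (1 / frac x) \<in> \<rat>" by (rule Rats_divide[OF Rats_1])
    then have "frac x + of_int \<lfloor>x\<rfloor> \<in> \<rat>" by (intro Rats_add) auto
    then show False using assms by (simp add: frac_def)
  qed
qed

text \<open>With \<open>x = a + t\<close> and \<open>y = a - s\<close>, where \<open>a\<close> is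
  the integer part of \<open>x\<close>, the two factors of the numerator scale by \<open>t\<close>
  and \<open>s\<close> and the denominator scales by \<open>t * s\<close>.\<close>

lemma cf_form_gauss_step:
  assumes "0 < frac x" and "y < of_int \<lfloor>x\<rfloor>"
  shows "cf_form x y (q + of_int \<lfloor>x\<rfloor> * p) p = cf_form (1 / frac x) (1 / (y - of_int \<lfloor>x\<rfloor>)) p q"
proof -
  define t s where "t = frac x" and "s = of_int \<lfloor>x\<rfloor> - y"
  have pos: "0 < t" "0 < s" using assms by (auto simp: t_def s_def)
  have x: "x = of_int \<lfloor>x\<rfloor> + t" and y: "y = of_int \<lfloor>x\<rfloor> - s" by (auto simp: t_def s_def frac_def)
  have "q + of_int \<lfloor>x\<rfloor> * p - p * x = - (t * (p - q * (1 / t)))"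
    using pos by (subst (2) x) (simp add: field_simps)
  then have 1: "\<bar>q + of_int \<lfloor>x\<rfloor> * p - p * x\<bar> = t * \<bar>p - q * (1 / t)\<bar>"
    using pos by (simp add: abs_mult)
  have 2: "q + of_int \<lfloor>x\<rfloor> * p - p * y = s * (p - q * (1 / (- s)))"
    using pos by (simp add: s_def field_simps)
  have 3: "x - y = t * s * (1 / t - 1 / (- s))"
    using pos by (subst x, subst y) (simp add: field_simps)
  have ys: "y - of_int \<lfloor>x\<rfloor> = - s" by (simp add: s_def)
  show ?thesis unfolding cf_form_def 1 2 ys t_def[symmetric] unfolding 3 using pos by (simp add: divide_simps)
qed

text \<open>If \<open>x1 = 1 / frac x\<close> is just above 1, its integer part is 1 and
  \<open>1 - frac x = 1 / (x1 * x2)\<close>, so the quotient after that keeps the value away from 0.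
  This controls approximations of \<open>x\<close> from above.\<close>

lemma one_minus_frac_ge:
  assumes irr: "x \<notin> \<rat>" and M: "\<And>k. of_int (partial_quotient x k) \<le> M"
  shows "1 / (2 * (M + 1)) \<le> 1 - frac x"
proof -
  define x1 where "x1 = 1 / frac x"
  define x2 where "x2 = 1 / frac x1"
  have i1: "x1 \<notin> \<rat>" "1 < x1" using irrational_frac[OF irr] by (auto simp: x1_def)
  have i2: "x2 \<notin> \<rat>" "1 < x2" using irrational_frac[OF i1(1)] by (auto simp: x2_def)
  have fx: "frac x = 1 / x1" and fx1: "frac x1 = 1 / x2" by (auto simp: x1_def x2_def)
  have "of_int \<lfloor>x2\<rfloor> \<le> M" using M[of "Suc (Suc 0)"] by (simp add: x1_def x2_def)
  moreover have "1 \<le> \<lfloor>x2\<rfloor>" using i2 by linarith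
  ultimately have x2: "x2 \<le> M + 1" and M1: "1 \<le> M" by linarith+
  show ?thesis
  proof (cases "2 \<le> x1")
    case True
    then have "1 / x1 \<le> 1/2" by (simp add: field_simps)
    moreover have "1 / (2 * (M + 1)) \<le> 1 / 2" using M1 by (simp add: field_simps)
    ultimately show ?thesis unfolding fx by linarith
  next
    case False
    then have "\<lfloor>x1\<rfloor> = 1" using i1 by linarith
    then have x1: "x1 = 1 + 1 / x2" using fx1 by (simp add: frac_def)
    have "1 - frac x = (1 / x2) / x1"
    proof -
      have "1 - 1 / x1 = (x1 - 1) / x1" using i1 by (simp add: diff_divide_distrib)
      also have "x1 - 1 = 1 / x2" using x1 by simp
      finally show ?thesis unfolding fx .
    qed
    moreover have "(1 / (M + 1)) / 2 \<le> (1 / x2) / x1"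
      using i1 i2 x2 M1 False by (intro frac_le) (auto simp: field_simps)
    ultimately show ?thesis by (simp add: algebra_simps)
  qed
qed

text \<open>This is the Euclidean algorithm on \<open>(p, q)\<close> run in step with the Gauss map.
  If \<open>p / q\<close> is not strictly between \<lfloor>x\<rfloor> and the next integer, the
  first factor is at least \<open>frac x\<close> or \<open>1 - frac x\<close> and the estimate is
  direct. Otherwise a Gauss step replaces \<open>q\<close> by the smaller
  \<open>p - \<lfloor>x\<rfloor> * q\<close>. The conditions on \<open>y\<close> survive that step;
  the last hypothesis covers \<open>p = 0\<close>, where the second factor is only
  \<open>- q * y\<close>.\<close>

lemma cf_form_lower_bound:
  fixes p q :: int
  assumes "x \<notin> \<rat>" and "\<And>k. of_int (partial_quotient x k) \<le> M"
    and "- 1 \<le> y" and "y < 0" and "y + 1 \<le> of_int \<lfloor>x\<rfloor>"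
    and "1 \<le> q" and "0 \<le> p" and "1 \<le> p \<or> y = - 1"
  shows "1 / ((M + 1) * (M + 2)) \<le> cf_form x y (of_int p) (of_int q)"
  using assms
proof (induction "nat q" arbitrary: x y p q rule: less_induct)
  case less
  note irr = less.prems(1) and M = less.prems(2)
  let ?a = "\<lfloor>x\<rfloor>" and ?x1 = "1 / frac x" and ?y1 = "1 / (y - of_int \<lfloor>x\<rfloor>)"
  let ?P = "of_int p :: real" and ?Q = "of_int q :: real"
  note fr = irrational_frac[OF irr]
  have x: "x = of_int ?a + frac x" by (simp add: frac_def)
  have a0: "0 \<le> ?a" using less.prems(3,5) by linarith
  have xM: "x < M + 1" using M[of 0] by (simp; linarith)
  have x1M: "of_int \<lfloor>?x1\<rfloor> \<le> M" using M[of 1] by simp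
  then have "?x1 < M + 1" by linarith
  moreover have x1_ge: "1 \<le> \<lfloor>?x1\<rfloor>" using fr(4) by linarith
  ultimately have M1: "1 \<le> M" using x1M by linarith
  have frM: "1 / (M + 1) \<le> frac x"
    using \<open>?x1 < M + 1\<close> fr(1) M1 by (simp add: divide_simps mult.commute)
  have xy: "0 < x - y" "x - y \<le> M + 2" using xM less.prems x a0 fr by linarith+
  have Q1: "1 \<le> ?Q" using less.prems by simp
  consider "p \<le> ?a * q" | "(?a + 1) * q \<le> p" | "?a * q < p" "p < (?a + 1) * q" by linarith
  then show ?case
  proof cases
    case 1
    have P: "?P \<le> of_int ?a * ?Q" using 1 by (metis of_int_le_iff of_int_mult)
    have "frac x \<le> ?Q * frac x" using Q1 fr by simp
    also have "?Q * frac x \<le> ?Q * x - ?P" using P by (simp add: frac_def algebra_simps)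
    finally have a: "1 / (M + 1) \<le> \<bar>?P - ?Q * x\<bar>" using frM by linarith
    have b: "1 \<le> ?P - ?Q * y"
    proof (cases "1 \<le> p")
      case True
      moreover have "?Q * y \<le> 0" using Q1 less.prems by (simp add: mult_nonneg_nonpos)
      ultimately show ?thesis by linarith
    next
      case False
      then show ?thesis using less.prems Q1 by simp
    qed
    have "1 / ((M + 1) * (M + 2)) = (1 / (M + 1)) * 1 / (M + 2)" by simp
    also have "\<dots> \<le> cf_form x y ?P ?Q"
      unfolding cf_form_def using a b xy M1 by (intro frac_le mult_mono) auto
    finally show ?thesis .
  next
    case 2
    have P: "(of_int ?a + 1) * ?Q \<le> ?P" using 2 by (metis of_int_le_iff of_int_mult of_int_add of_int_1)
    have "1 - frac x \<le> ?Q * (1 - frac x)" using Q1 fr mult_right_mono[of 1 ?Q "1 - frac x"] by simp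
    also have "\<dots> \<le> ?P - ?Q * x" using P by (simp add: frac_def algebra_simps)
    finally have PQ: "1 - frac x \<le> ?P - ?Q * x" .
    then have a: "1 - frac x \<le> \<bar>?P - ?Q * x\<bar>" by linarith
    have "?Q * x \<le> ?P" using PQ fr by linarith
    then have "?Q * (x - y) \<le> ?P - ?Q * y" by (simp add: algebra_simps)
    moreover have "x - y \<le> ?Q * (x - y)" using Q1 xy mult_right_mono[of 1 ?Q "x - y"] by simp
    ultimately have b: "x - y \<le> ?P - ?Q * y" by (rule order_trans[rotated])
    have "2 * (M + 1) \<le> (M + 2) * (M + 1)" using M1 by (intro mult_right_mono) auto
    then have "1 / ((M + 1) * (M + 2)) \<le> 1 / (2 * (M + 1))"
      using M1 by (intro divide_left_mono) (auto simp: mult.commute)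
    also have "\<dots> \<le> 1 - frac x" by (rule one_minus_frac_ge[OF irr M])
    also have "\<dots> = (1 - frac x) * (x - y) / (x - y)" using xy by simp
    also have "\<dots> \<le> cf_form x y ?P ?Q"
      unfolding cf_form_def using a b xy fr by (intro divide_right_mono mult_mono) auto
    finally show ?thesis .
  next
    case 3
    let ?q = "p - ?a * q"
    have "1 / ((M + 1) * (M + 2)) \<le> cf_form ?x1 ?y1 (of_int q) (of_int ?q)"
    proof (rule less.hyps)
      show "nat ?q < nat q" using 3 less.prems by (simp add: algebra_simps)
      show "?x1 \<notin> \<rat>" by (rule fr(3))
      show "of_int (partial_quotient ?x1 k) \<le> M" for k using M[of "Suc k"] by simp
      have ya: "y - of_int ?a \<le> - 1" using less.prems by linarith
      show "- 1 \<le> ?y1" "?y1 < 0" using ya by (auto simp: divide_simps)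
      then show "?y1 + 1 \<le> of_int \<lfloor>?x1\<rfloor>" using x1_ge by linarith
      show "1 \<le> ?q" using 3 by linarith
      show "0 \<le> q" "1 \<le> q \<or> ?y1 = - 1" using less.prems by auto
    qed
    also have "\<dots> = cf_form x y (of_int ?q + of_int ?a * of_int q) (of_int q)"
      using cf_form_gauss_step[of x y "of_int ?q" "of_int q"] fr less.prems by simp
    also have "of_int ?q + of_int ?a * of_int q = ?P" by simp
    finally show ?thesis .
  qed
qed

text \<open>At \<open>(1, 0)\<close> the hypothesis bounds \<open>x - y\<close>, hence
  \<lfloor>x\<rfloor>, by \<open>1 / c\<close>. The Gauss step sends nonnegative nonzero pairs to
  such pairs, so the same \<open>c\<close> serves every later complete quotient.\<close>

lemma partial_quotient_le_of_cf_form: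
  assumes "x \<notin> \<rat>" and "0 < x" and "y < 0"
    and "\<And>p q :: int. 0 \<le> p \<Longrightarrow> 0 \<le> q \<Longrightarrow> 1 \<le> p + q \<Longrightarrow> c \<le> cf_form x y (of_int p) (of_int q)"
    and "0 < c"
  shows "c * of_int (partial_quotient x k) \<le> 1"
  using assms
proof (induction k arbitrary: x y)
  case 0
  have "c \<le> 1 / (x - y)" using "0.prems"(4)[of 1 0] "0.prems"(2,3) by (simp add: cf_form_def)
  then have "c * (x - y) \<le> 1" using "0.prems" by (simp add: field_simps)
  moreover have "c * of_int \<lfloor>x\<rfloor> \<le> c * (x - y)" using "0.prems" by (intro mult_left_mono) linarith+
  ultimately show ?case by simp
next
  case (Suc k)
  note fr = irrational_frac[OF Suc.prems(1)]
  have a0: "0 \<le> \<lfloor>x\<rfloor>" using Suc.prems(2) by simp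
  then have ya: "y < of_int \<lfloor>x\<rfloor>" using Suc.prems(3) by linarith
  have "c * of_int (partial_quotient (1 / frac x) k) \<le> 1"
  proof (rule Suc.IH)
    show "1 / frac x \<notin> \<rat>" "0 < 1 / frac x" using fr by auto
    show "1 / (y - of_int \<lfloor>x\<rfloor>) < 0" using ya by simp
    show "c \<le> cf_form (1 / frac x) (1 / (y - of_int \<lfloor>x\<rfloor>)) (of_int p) (of_int q)"
      if "0 \<le> p" "0 \<le> q" "1 \<le> p + q" for p q :: int
    proof -
      have "1 \<le> q + \<lfloor>x\<rfloor> * p + p"
        using that a0 mult_nonneg_nonneg[of "\<lfloor>x\<rfloor>" p] by linarith
      then show ?thesis
        using Suc.prems(4)[of "q + \<lfloor>x\<rfloor> * p" p] that a0 cf_form_gauss_step[OF fr(1) ya, of "of_int q" "of_int p"]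
        by simp
    qed
  qed (rule Suc.prems)
  then show ?case by simp
qed

lemma bounded_partial_quotients_iff_badly_approximable:
  assumes "0 < \<theta>" and "\<theta> < 1" and irr: "\<theta> \<notin> \<rat>"
  shows "bounded_partial_quotients \<theta> \<longleftrightarrow> badly_approximable (\<theta> / (1 + \<theta>))"
proof
  \<comment> \<open>For \<open>y = - 1\<close> the second factor is \<open>p + q = i\<close>, and
    the factor \<open>1 + \<theta>\<close> of the first cancels against
    \<open>x - y\<close>.\<close>
  have form: "cf_form \<theta> (- 1) (of_int j) (of_int (int i - j)) =
      real i * \<bar>real i * (\<theta> / (1 + \<theta>)) - of_int j\<bar>" for i :: nat and j :: int
  proof -
    have "of_int j - of_int (int i - j) * \<theta> = - ((1 + \<theta>) * (real i * (\<theta> / (1 + \<theta>)) - of_int j))"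
      using assms by (simp add: field_simps)
    then have "\<bar>of_int j - of_int (int i - j) * \<theta>\<bar> = (1 + \<theta>) * \<bar>real i * (\<theta> / (1 + \<theta>)) - of_int j\<bar>"
      using assms by (simp only: abs_minus_cancel abs_mult)
    moreover have "of_int j - of_int (int i - j) * - 1 = real i" and "\<theta> - - 1 = 1 + \<theta>" by simp_all
    moreover have "(1 + \<theta>) * z * real i / (1 + \<theta>) = real i * z" for z
      using assms by simp
    ultimately show ?thesis unfolding cf_form_def by metis
  qed
  {
    assume "bounded_partial_quotients \<theta>"
    then obtain M :: int where M: "\<And>k. partial_quotient \<theta> k \<le> M"
      unfolding bounded_partial_quotients_def by blast
    have "1 \<le> \<lfloor>1 / frac \<theta>\<rfloor>" using irrational_frac(4)[OF irr] by linarith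
    then have M1: "1 \<le> M" using M[of 1] by (simp; linarith)
    define c :: real where "c = 1 / ((of_int M + 1) * (of_int M + 2))"
    have "(2::real) * 3 \<le> (of_int M + 1) * (of_int M + 2)" using M1 by (intro mult_mono) auto
    then have c: "0 < c" "c \<le> 1 / 2" by (auto simp: c_def divide_simps)
    show "badly_approximable (\<theta> / (1 + \<theta>))" unfolding badly_approximable_def
    proof (intro exI[of _ c] conjI allI impI)
      fix i :: nat and j :: int
      assume i: "1 \<le> i"
      have ci: "c / real i \<le> 1 / 2" using c i by (simp add: field_simps)
      \<comment> \<open>The bound on the form covers \<open>0 \<le> j < i\<close>. Since
        \<open>0 < \<alpha> < 1 / 2\<close>, all other \<open>j\<close> are at distance at least 1/2
        from \<open>i * \<alpha>\<close>, hence the requirement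
        \<open>c \<le> 1 / 2\<close>.\<close>
      consider "j < 0" | "int i \<le> j" | "0 \<le> j" "j < int i" by linarith
      then show "c / real i \<le> \<bar>real i * (\<theta> / (1 + \<theta>)) - of_int j\<bar>"
      proof cases
        case 1
        then have "of_int j \<le> (- 1 :: real)" by linarith
        moreover have "0 \<le> real i * (\<theta> / (1 + \<theta>))" using assms by simp
        ultimately show ?thesis using ci by linarith
      next
        case 2
        then have "real i \<le> of_int j" by linarith
        moreover have "real i * (\<theta> / (1 + \<theta>)) \<le> real i * (1 / 2)"
          using assms by (intro mult_left_mono) (auto simp: field_simps)
        moreover have "1 \<le> real i" using i by simp
        ultimately show ?thesis using ci by linarith
      next
        case 3
        have "c \<le> cf_form \<theta> (- 1) (of_int j) (of_int (int i - j))" unfolding c_def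
          by (rule cf_form_lower_bound[OF irr]) (use 3 assms M in auto)
        then show ?thesis using i unfolding form by (simp add: field_simps)
      qed
    qed (rule c)
  }
  {
    assume "badly_approximable (\<theta> / (1 + \<theta>))"
    then obtain c where c: "0 < c"
      and ba: "\<And>(i::nat) (j::int). i \<ge> 1 \<Longrightarrow> c / real i \<le> \<bar>real i * (\<theta> / (1 + \<theta>)) - of_int j\<bar>"
      unfolding badly_approximable_def by blast
    have "c * of_int (partial_quotient \<theta> k) \<le> 1" for k
    proof (rule partial_quotient_le_of_cf_form[OF irr, where y = "- 1"])
      fix p q :: int
      assume pq: "0 \<le> p" "0 \<le> q" "1 \<le> p + q"
      have "c / real (nat (p + q)) \<le> \<bar>real (nat (p + q)) * (\<theta> / (1 + \<theta>)) - of_int p\<bar>"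
        using pq by (intro ba) auto
      then have "c \<le> real (nat (p + q)) * \<bar>real (nat (p + q)) * (\<theta> / (1 + \<theta>)) - of_int p\<bar>"
        using pq by (simp add: field_simps)
      then show "c \<le> cf_form \<theta> (- 1) (of_int p) (of_int q)"
        using form[of p "nat (p + q)"] pq by simp
    qed (use assms c in auto)
    then have "of_int (partial_quotient \<theta> k) \<le> 1 / c" for k
      using c by (simp add: field_simps)
    then have "partial_quotient \<theta> k \<le> \<lceil>1 / c\<rceil>" for k
      by (metis ceiling_mono ceiling_of_int)
    then show "bounded_partial_quotients \<theta>" unfolding bounded_partial_quotients_def by blast
  }
qed

section \<open>Sturmian words as codings of rotations\<close>

text \<open>The lower mechanical word of slope \<alpha> and intercept \<open>y\<close>: for
  \<open>0 < \<alpha> < 1\<close> the floor grows by one exactly at the letters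
  \<open>LetterB\<close>.\<close>

definition rot_code :: "real \<Rightarrow> real \<Rightarrow> nat \<Rightarrow> letter" where
  "rot_code \<alpha> y j = (if \<lfloor>y + real (Suc j) * \<alpha>\<rfloor> = \<lfloor>y + real j * \<alpha>\<rfloor> then LetterA else LetterB)"

definition rot_word :: "real \<Rightarrow> real \<Rightarrow> nat \<Rightarrow> letter list" where
  "rot_word \<alpha> y n = map (rot_code \<alpha> y) [0..<n]"

lemma length_rot_word [simp]: "length (rot_word \<alpha> y n) = n"
  by (simp add: rot_word_def)

lemma nth_rot_word [simp]: "i < n \<Longrightarrow> rot_word \<alpha> y n ! i = rot_code \<alpha> y i"
  by (simp add: rot_word_def)

lemma rot_word_Suc: "rot_word \<alpha> y (Suc n) = rot_word \<alpha> y n @ [rot_code \<alpha> y n]"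
  by (simp add: rot_word_def)

lemma rot_code_shift: "rot_code \<alpha> (y + real i * \<alpha>) j = rot_code \<alpha> y (i + j)"
  by (simp add: rot_code_def algebra_simps)

lemma rot_code_cong:
  "\<lfloor>y + real j * \<alpha>\<rfloor> = \<lfloor>y' + real j * \<alpha>\<rfloor> \<Longrightarrow> \<lfloor>y + real (Suc j) * \<alpha>\<rfloor> = \<lfloor>y' + real (Suc j) * \<alpha>\<rfloor> \<Longrightarrow>
    rot_code \<alpha> y j = rot_code \<alpha> y' j"
  unfolding rot_code_def by simp

lemma rot_word_cong:
  assumes "\<And>j. j \<le> n \<Longrightarrow> \<lfloor>y + real j * \<alpha>\<rfloor> = \<lfloor>y' + real j * \<alpha>\<rfloor>"
  shows "rot_word \<alpha> y n = rot_word \<alpha> y' n"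
  unfolding rot_word_def using assms by (intro map_cong refl rot_code_cong) (auto simp del: of_nat_Suc)

lemma rot_code_add_int: "rot_code \<alpha> (y + of_int k) = rot_code \<alpha> y"
proof
  fix j
  have "\<lfloor>y + of_int k + r\<rfloor> = \<lfloor>y + r\<rfloor> + k" for r :: real
    by (metis add.assoc add.commute floor_add_int)
  then show "rot_code \<alpha> (y + of_int k) j = rot_code \<alpha> y j" by (simp add: rot_code_def)
qed

lemma rot_word_add_int: "rot_word \<alpha> (y + of_int k) n = rot_word \<alpha> y n"
  by (simp add: rot_word_def rot_code_add_int)

lemma floor_Suc_mult:
  assumes "0 < \<alpha>" "\<alpha> < 1"
  shows "\<lfloor>y + real (Suc j) * \<alpha>\<rfloor> =
    (if rot_code \<alpha> y j = LetterA then \<lfloor>y + real j * \<alpha>\<rfloor> else \<lfloor>y + real j * \<alpha>\<rfloor> + 1)"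
proof -
  have "y + real (Suc j) * \<alpha> = y + real j * \<alpha> + \<alpha>" by (simp add: algebra_simps)
  moreover have "\<lfloor>z + \<alpha>\<rfloor> = \<lfloor>z\<rfloor> \<or> \<lfloor>z + \<alpha>\<rfloor> = \<lfloor>z\<rfloor> + 1" for z using assms by linarith
  ultimately show ?thesis unfolding rot_code_def by (metis letter.distinct(1))
qed

lemma rot_word_floors:
  assumes "0 < \<alpha>" "\<alpha> < 1" and "rot_word \<alpha> y n = rot_word \<alpha> y' n" and "\<lfloor>y\<rfloor> = \<lfloor>y'\<rfloor>" and "j \<le> n"
  shows "\<lfloor>y + real j * \<alpha>\<rfloor> = \<lfloor>y' + real j * \<alpha>\<rfloor>"
  using \<open>j \<le> n\<close>
proof (induction j)
  case 0
  then show ?case using assms(4) by simp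
next
  case (Suc j)
  then have "rot_code \<alpha> y j = rot_code \<alpha> y' j"
    using assms(3) nth_rot_word[of j n \<alpha>] by (metis Suc_le_lessD)
  then show ?case unfolding floor_Suc_mult[OF assms(1,2)] using Suc by simp
qed

text \<open>Floors are right continuous, so a small shift to the right preserves finitely many of
  them, and only countably many shifts put the orbit on an integer. This reconciles codings of
  arbitrary points with lines that must miss the lattice.\<close>

lemma generic_perturbation:
  "\<exists>y'. (\<forall>j\<le>n. \<lfloor>y' + real j * \<alpha>\<rfloor> = \<lfloor>y + real j * \<alpha>\<rfloor>) \<and> (\<forall>i::int. y' + of_int i * \<alpha> \<notin> \<int>)"
proof -
  let ?e = "\<lambda>j. of_int \<lfloor>y + real j * \<alpha>\<rfloor> + 1 - (y + real j * \<alpha>)"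
  define \<epsilon> where "\<epsilon> = Min (?e ` {..n})"
  have "0 < ?e j" for j by linarith
  then have \<epsilon>: "0 < \<epsilon>" unfolding \<epsilon>_def by (subst Min_gr_iff) auto
  define bad where "bad = (\<lambda>(i::int, k::int). of_int k - of_int i * \<alpha>) ` UNIV"
  have "countable bad" unfolding bad_def by simp
  moreover have "uncountable {y<..<y + \<epsilon>}" using \<epsilon> by (simp add: uncountable_open_interval)
  ultimately have "\<not> {y<..<y + \<epsilon>} \<subseteq> bad" using countable_subset by blast
  then obtain y' where "y' \<in> {y<..<y + \<epsilon>}" and "y' \<notin> bad" by blast
  then have y': "y < y'" "y' < y + \<epsilon>" "y' \<notin> bad" by auto
  have "\<lfloor>y' + real j * \<alpha>\<rfloor> = \<lfloor>y + real j * \<alpha>\<rfloor>" if "j \<le> n" for j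
  proof -
    have "\<epsilon> \<le> ?e j" unfolding \<epsilon>_def using that by (intro Min_le) auto
    then show ?thesis using y' by linarith
  qed
  moreover have "y' + of_int i * \<alpha> \<notin> \<int>" for i :: int
  proof
    assume "y' + of_int i * \<alpha> \<in> \<int>"
    then obtain k :: int where "y' + of_int i * \<alpha> = of_int k" by (auto elim: Ints_cases)
    then have "y' = (\<lambda>(i::int, k::int). of_int k - of_int i * \<alpha>) (i, k)" by simp
    then show False using y'(3) unfolding bad_def by blast
  qed
  ultimately show ?thesis by blast
qed

section \<open>Staircases in a strip and rotation orbits\<close>

lemma on_line_iff:
  "z \<in> range (\<lambda>t. q + t *\<^sub>R (1, \<theta>)) \<longleftrightarrow> snd z - \<theta> * fst z = snd q - \<theta> * fst q" for q z :: "real \<times> real"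
proof
  assume *: "snd z - \<theta> * fst z = snd q - \<theta> * fst q"
  show "z \<in> range (\<lambda>t. q + t *\<^sub>R (1, \<theta>))"
    by (rule range_eqI[of _ _ "fst z - fst q"]) (use * in \<open>simp add: prod_eq_iff algebra_simps\<close>)
qed (auto simp: algebra_simps)

lemma strip_points_iff:
  assumes "0 < \<theta>"
  shows "z \<in> strip_points (range (\<lambda>t. q + t *\<^sub>R (1, \<theta>))) \<longleftrightarrow>
    of_int (snd z) - \<theta> * of_int (fst z) - (snd q - \<theta> * fst q) \<in> {- \<theta>..1}"
    (is "_ \<longleftrightarrow> ?v \<in> _")
proof
  assume "z \<in> strip_points (range (\<lambda>t. q + t *\<^sub>R (1, \<theta>)))"
  then obtain e s t where *: "e \<in> range (\<lambda>t. q + t *\<^sub>R (1, \<theta>))" "s \<in> {0..1}" "t \<in> {0..1}"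
    "lattice_point z = e + (s, t)"
    unfolding strip_points_def by blast
  then have "?v = t - \<theta> * s" unfolding on_line_iff lattice_point_def
    by (simp add: prod_eq_iff algebra_simps)
  moreover have "0 \<le> \<theta> * s" "\<theta> * s \<le> \<theta>" using assms * by (simp_all add: mult_left_le)
  ultimately show "?v \<in> {- \<theta>..1}" using * by simp
next
  assume v: "?v \<in> {- \<theta>..1}"
  \<comment> \<open>A nonnegative height is attained on the left side of the unit square, a negative
    one on the bottom side.\<close>
  define s where "s = (if 0 \<le> ?v then 0 else - ?v / \<theta>)"
  define t where "t = (if 0 \<le> ?v then ?v else 0)"
  have "?v = t - \<theta> * s" "s \<in> {0..1}" "t \<in> {0..1}"
    using v assms by (auto simp: s_def t_def field_simps)
  moreover from this have "lattice_point z - (s, t) \<in> range (\<lambda>t. q + t *\<^sub>R (1, \<theta>))"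
    unfolding on_line_iff by (simp add: lattice_point_def algebra_simps)
  ultimately show "z \<in> strip_points (range (\<lambda>t. q + t *\<^sub>R (1, \<theta>)))"
    unfolding strip_points_def
    by (intro CollectI bexI[of _ "lattice_point z - (s, t)"] bexI[of _ s] bexI[of _ t]) auto
qed

text \<open>Heights in the open strip differ by less than \<open>1 + \<theta>\<close>, whereas a
  vector whose coordinates have strictly opposite signs changes the height by at least
  \<open>1 + \<theta>\<close>. Hence the coordinate sum orders the points as the projection
  does.\<close>

lemma strip_order:
  fixes z z' :: "int \<times> int"
  assumes "0 < \<theta>"
    and h: "- \<theta> < of_int (snd z) - \<theta> * of_int (fst z) - r" "of_int (snd z) - \<theta> * of_int (fst z) - r < 1"
    and h': "- \<theta> < of_int (snd z') - \<theta> * of_int (fst z') - r" "of_int (snd z') - \<theta> * of_int (fst z') - r < 1"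
  shows "fst z + snd z = fst z' + snd z' \<Longrightarrow> z = z'"
    and "fst z + snd z < fst z' + snd z' \<Longrightarrow>
      lattice_point z \<bullet> (1, \<theta>) < lattice_point z' \<bullet> (1, \<theta>)"
proof -
  define m n where "m = fst z' - fst z" and "n = snd z' - snd z"
  have mn: "of_int n - \<theta> * of_int m < 1 + \<theta>" "- (1 + \<theta>) < of_int n - \<theta> * of_int m"
    using h h' by (auto simp: m_def n_def algebra_simps)
  have m: "0 \<le> m" if "0 \<le> m + n"
  proof (rule ccontr)
    assume "\<not> ?thesis"
    then have "m \<le> - 1" "1 \<le> n" using that by auto
    then have "of_int m \<le> (- 1 :: real)" "(1 :: real) \<le> of_int n" by linarith+
    moreover from this have "\<theta> * of_int m \<le> \<theta> * - 1" using assms(1) by (intro mult_left_mono) auto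
    ultimately show False using mn by linarith
  qed
  have n: "0 \<le> n" if "0 \<le> m + n"
  proof (rule ccontr)
    assume "\<not> ?thesis"
    then have "n \<le> - 1" "1 \<le> m" using that by auto
    then have "of_int n \<le> (- 1 :: real)" "(1 :: real) \<le> of_int m" by linarith+
    moreover from this have "\<theta> * 1 \<le> \<theta> * of_int m" using assms(1) by (intro mult_left_mono) auto
    ultimately show False using mn by linarith
  qed
  show "z = z'" if "fst z + snd z = fst z' + snd z'"
  proof -
    have "m + n = 0" using that by (simp add: m_def n_def)
    then have "m = 0" "n = 0" using m n by auto
    then show ?thesis by (simp add: m_def n_def prod_eq_iff)
  qed
  show "lattice_point z \<bullet> (1, \<theta>) < lattice_point z' \<bullet> (1, \<theta>)" if "fst z + snd z < fst z' + snd z'"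
  proof -
    have mn1: "1 \<le> m + n" using that by (simp add: m_def n_def)
    have "0 < of_int m + \<theta> * of_int n"
    proof (cases "m = 0")
      case True
      then show ?thesis using mn1 assms(1) by simp
    next
      case False
      then show ?thesis using mn1 m n assms(1) by (intro add_pos_nonneg) auto
    qed
    then show ?thesis by (simp add: lattice_point_def m_def n_def algebra_simps)
  qed
qed

lemma staircase_step:
  assumes \<theta>: "0 < \<theta>" and E0: "E0 = range (\<lambda>t. q + t *\<^sub>R (1, \<theta>))" and r: "r = snd q - \<theta> * fst q"
    and miss: "E0 \<inter> range lattice_point = {}" and p: "staircase \<theta> E0 p"
    and h: "h = (\<lambda>i. of_int (snd (p i)) - \<theta> * of_int (fst (p i)) - r)"
  shows "- \<theta> < h i" and "h i < 1" and "p (i + 1) = p i + (if 0 < h i then (1, 0) else (0, 1))"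
proof -
  have rng: "range p = strip_points E0" and mono: "strict_mono (\<lambda>i. lattice_point (p i) \<bullet> (1, \<theta>))"
    using p by (auto simp: staircase_def)
  have off: "of_int b - \<theta> * of_int a \<noteq> r" for a b :: int
  proof
    assume "of_int b - \<theta> * of_int a = r"
    then have "lattice_point (a, b) \<in> E0" unfolding E0 on_line_iff by (simp add: lattice_point_def r)
    then show False using miss by blast
  qed
  \<comment> \<open>Height 1 would put the lattice neighbour below on the line, and height
    \<open>- \<theta>\<close> the neighbour to the left, so no lattice point lies on the boundary of
    the strip.\<close>
  have strip: "z \<in> range p \<longleftrightarrow> - \<theta> < of_int (snd z) - \<theta> * of_int (fst z) - r \<and>
      of_int (snd z) - \<theta> * of_int (fst z) - r < 1" for z
    using off[of "snd z - 1" "fst z"] off[of "snd z" "fst z - 1"]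
    unfolding rng E0 strip_points_iff[OF \<theta>] r[symmetric] by (auto simp: algebra_simps)
  show h_bounds: "- \<theta> < h i" "h i < 1" for i
    using strip[of "p i"] by (auto simp: h)
  \<comment> \<open>The sign of the height decides which neighbour stays in the strip. Its
    coordinate sum is larger by one and indices follow the coordinate sum, so no index fits in
    between.\<close>
  let ?z = "p i + (if 0 < h i then (1, 0) else (0, 1))"
  have "h i \<noteq> 0" using off[of "snd (p i)" "fst (p i)"] by (simp add: h)
  then have "- \<theta> < of_int (snd ?z) - \<theta> * of_int (fst ?z) - r \<and>
      of_int (snd ?z) - \<theta> * of_int (fst ?z) - r < 1"
    using h_bounds[of i] \<theta> by (auto simp: h algebra_simps)
  then obtain j where j: "p j = ?z" using strip by (metis rangeE)
  have sum_z: "fst ?z + snd ?z = fst (p i) + snd (p i) + 1" by simp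
  note order = strip_order[OF \<theta>, of "p _" r "p _"]
  have less: "i' < j' \<longleftrightarrow> fst (p i') + snd (p i') < fst (p j') + snd (p j')" for i' j'
  proof -
    have "fst (p i') + snd (p i') < fst (p j') + snd (p j') \<Longrightarrow> i' < j'" for i' j'
      using order(2)[of i' j'] h_bounds strict_mono_less[OF mono, of i' j'] by (simp add: h)
    moreover have "fst (p i') + snd (p i') = fst (p j') + snd (p j') \<Longrightarrow> i' = j'"
      using order(1)[of i' j'] h_bounds strict_mono_eq[OF mono, of i' j'] by (simp add: h)
    ultimately show ?thesis by (metis less_asym linorder_neqE)
  qed
  have "i < j" using less[of i j] j sum_z by simp
  moreover have "\<not> i + 1 < j" using less[of i "i + 1"] less[of "i + 1" j] j sum_z by auto
  ultimately show "p (i + 1) = ?z" using j by (metis add1_zle_eq order_le_less)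
qed

text \<open>The quantity \<open>1 - \<alpha> - h / (1 + \<theta>)\<close> lies strictly between 0
  and 1 and serves as the fractional part of the orbit: \<open>(1, 0)\<close> adds \<alpha> to it,
  \<open>(0, 1)\<close> adds \<open>\<alpha> - 1\<close>, so the integer part counts vertical
  steps.\<close>

lemma staircase_word:
  assumes \<theta>: "0 < \<theta>" and "line_of_slope \<theta> E0" and miss: "E0 \<inter> range lattice_point = {}" and p: "staircase \<theta> E0 p"
  shows "\<exists>y. \<forall>j. step_word p (k + int j) = rot_code (\<theta> / (1 + \<theta>)) y j"
proof -
  obtain q where E0: "E0 = range (\<lambda>t. q + t *\<^sub>R (1, \<theta>))" using assms by (auto simp: line_of_slope_def)
  define r h where "r = snd q - \<theta> * fst q" and "h = (\<lambda>i. of_int (snd (p i)) - \<theta> * of_int (fst (p i)) - r)"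
  note step = staircase_step[OF \<theta> E0 r_def miss p h_def]
  define \<alpha> where "\<alpha> = \<theta> / (1 + \<theta>)"
  have \<alpha>: "1 - \<alpha> = 1 / (1 + \<theta>)" using \<theta> by (simp add: \<alpha>_def field_simps)
  define y where "y = 1 - \<alpha> - h k / (1 + \<theta>)"
  have rot: "y + real j * \<alpha> = 1 - \<alpha> - h (k + int j) / (1 + \<theta>) + of_int (snd (p (k + int j)) - snd (p k))" for j
  proof (induction j)
    case 0
    then show ?case by (simp add: y_def)
  next
    case (Suc j)
    let ?i = "k + int j"
    have i: "k + int (Suc j) = ?i + 1" by simp
    have "\<alpha> = - (h (?i + 1) - h ?i) / (1 + \<theta>) + of_int (snd (p (?i + 1)) - snd (p ?i))"
    proof (cases "0 < h ?i")
      case True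
      then have P: "p (?i + 1) = p ?i + (1, 0)" using step(3) by simp
      show ?thesis unfolding h_def P by (simp add: \<alpha>_def algebra_simps)
    next
      case False
      then have P: "p (?i + 1) = p ?i + (0, 1)" using step(3) by simp
      show ?thesis unfolding h_def P using \<theta> by (simp add: \<alpha>_def field_simps)
    qed
    then show ?case using Suc unfolding i by (simp add: algebra_simps diff_divide_distrib)
  qed
  have floor: "\<lfloor>y + real j * \<alpha>\<rfloor> = snd (p (k + int j)) - snd (p k)" for j
  proof -
    have "h (k + int j) / (1 + \<theta>) < 1 - \<alpha>" "- \<alpha> < h (k + int j) / (1 + \<theta>)"
      using divide_strict_right_mono[OF step(1)[of "k + int j"], of "1 + \<theta>"]
        divide_strict_right_mono[OF step(2)[of "k + int j"], of "1 + \<theta>"] \<theta>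
      unfolding \<alpha> by (auto simp: \<alpha>_def)
    then show ?thesis unfolding rot by linarith
  qed
  have "step_word p (k + int j) = rot_code \<alpha> y j" for j
  proof -
    have i: "k + int (Suc j) = k + int j + 1" by simp
    show ?thesis
      using step(3)[of "k + int j"] unfolding step_word_def rot_code_def floor i by (cases "0 < h (k + int j)") simp_all
  qed
  then show ?thesis by (auto simp: \<alpha>_def)
qed

lemma staircase_of_generic_rotation:
  assumes \<theta>: "0 < \<theta>" "\<theta> < 1" and \<alpha>: "\<alpha> = \<theta> / (1 + \<theta>)" and generic: "\<And>i::int. y + of_int i * \<alpha> \<notin> \<int>"
  shows "\<exists>E0 p. line_of_slope \<theta> E0 \<and> E0 \<inter> range lattice_point = {} \<and> staircase \<theta> E0 p \<and>
    (\<forall>j. step_word p (int j) = rot_code \<alpha> y j)"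
proof -
  \<comment> \<open>Solves \<open>y = 1 - \<alpha> - h / (1 + \<theta>)\<close> for the line, with
    \<open>h = - r\<close> the height of the origin.\<close>
  define r where "r = (1 + \<theta>) * (y + \<alpha> - 1)"
  define E0 where "E0 = range (\<lambda>t. (0 :: real, r) + t *\<^sub>R (1, \<theta>))"
  define p where "p i = (i - \<lfloor>y + of_int i * \<alpha>\<rfloor>, \<lfloor>y + of_int i * \<alpha>\<rfloor>)" for i :: int
  have height: "of_int b - \<theta> * of_int a - r = (1 + \<theta>) * (of_int b - (y + of_int (a + b) * \<alpha>) + (1 - \<alpha>))" for a b :: int
    using \<theta> by (simp add: r_def \<alpha> field_simps)
  have bounds: "(1 + \<theta>) * (- \<alpha>) = - \<theta>" "(1 + \<theta>) * (1 - \<alpha>) = 1" using \<theta> by (simp_all add: \<alpha> field_simps)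
  have lt: "- \<theta> < (1 + \<theta>) * u \<longleftrightarrow> - \<alpha> < u" "(1 + \<theta>) * u < 1 \<longleftrightarrow> u < 1 - \<alpha>"
    and le: "- \<theta> \<le> (1 + \<theta>) * u \<longleftrightarrow> - \<alpha> \<le> u" "(1 + \<theta>) * u \<le> 1 \<longleftrightarrow> u \<le> 1 - \<alpha>" for u
    using \<theta> mult_less_cancel_left_pos[of "1 + \<theta>" "- \<alpha>" u] mult_less_cancel_left_pos[of "1 + \<theta>" u "1 - \<alpha>"]
      mult_le_cancel_left_pos[of "1 + \<theta>" "- \<alpha>" u] mult_le_cancel_left_pos[of "1 + \<theta>" u "1 - \<alpha>"]
    unfolding bounds by simp_all
  have not_int: "y + of_int i * \<alpha> \<noteq> of_int k" for i k :: int using generic[of i] by auto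
  have "E0 \<inter> range lattice_point = {}"
  proof (rule ccontr)
    assume "\<not> ?thesis"
    then obtain a b where "lattice_point (a, b) \<in> E0" by auto
    then have "of_int b - \<theta> * of_int a - r = 0" unfolding E0_def on_line_iff by (simp add: lattice_point_def)
    then have "of_int b - (y + of_int (a + b) * \<alpha>) + (1 - \<alpha>) = 0" unfolding height using \<theta> by simp
    then have "y + of_int (a + b + 1) * \<alpha> = of_int (b + 1)" by (simp add: algebra_simps)
    then show False using not_int by blast
  qed
  moreover have "staircase \<theta> E0 p"
  proof -
    \<comment> \<open>In the strip, \<open>snd z\<close> is within one below the orbit point indexed
      by the coordinate sum. As that point is no integer, the sum determines
      \<open>z\<close>.\<close>
    have strip: "z \<in> strip_points E0 \<longleftrightarrow> z = p (fst z + snd z)" for z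
    proof -
      have "z \<in> strip_points E0 \<longleftrightarrow>
          - 1 \<le> of_int (snd z) - (y + of_int (fst z + snd z) * \<alpha>) \<and> of_int (snd z) - (y + of_int (fst z + snd z) * \<alpha>) \<le> 0"
        unfolding E0_def strip_points_iff[OF \<theta>(1)]
        unfolding fst_conv snd_conv mult_zero_right diff_0_right atLeastAtMost_iff height le by auto
      also have "\<dots> \<longleftrightarrow> \<lfloor>y + of_int (fst z + snd z) * \<alpha>\<rfloor> = snd z"
        using not_int[of "fst z + snd z" "snd z"] not_int[of "fst z + snd z" "snd z + 1"]
        by (auto simp: floor_eq_iff)
      finally show ?thesis by (cases z) (auto simp: p_def)
    qed
    have "range p = strip_points E0"
    proof (intro equalityI subsetI)
      fix z assume "z \<in> strip_points E0"
      then have "z = p (fst z + snd z)" unfolding strip .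
      then show "z \<in> range p" by (rule range_eqI)
    next
      fix z assume "z \<in> range p"
      then show "z \<in> strip_points E0" unfolding strip by (auto simp: p_def)
    qed
    moreover have "lattice_point (p i) \<bullet> (1, \<theta>) < lattice_point (p j) \<bullet> (1, \<theta>)" if "i < j" for i j
    proof (rule strip_order(2)[where r = r])
      have h: "of_int (snd (p i)) - \<theta> * of_int (fst (p i)) - r = (1 + \<theta>) * (1 - \<alpha> - frac (y + of_int i * \<alpha>))" for i
        unfolding height by (simp add: p_def frac_def)
      have "0 < frac (y + of_int i * \<alpha>)" for i using generic by (simp add: frac_gt_0_iff)
      then show "of_int (snd (p i)) - \<theta> * of_int (fst (p i)) - r < 1"
          "of_int (snd (p j)) - \<theta> * of_int (fst (p j)) - r < 1"
        unfolding h lt by simp_all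
      have "frac (y + of_int i * \<alpha>) < 1" for i by (rule frac_lt_1)
      then show "- \<theta> < of_int (snd (p i)) - \<theta> * of_int (fst (p i)) - r"
          "- \<theta> < of_int (snd (p j)) - \<theta> * of_int (fst (p j)) - r"
        unfolding h lt by simp_all
    qed (use \<theta> that in \<open>auto simp: p_def\<close>)
    ultimately show ?thesis by (auto simp: staircase_def strict_mono_def)
  qed
  moreover have "step_word p (int j) = rot_code \<alpha> y j" for j
    by (auto simp: step_word_def rot_code_def p_def algebra_simps)
  ultimately show ?thesis unfolding line_of_slope_def E0_def by blast
qed

lemma sturmian_language_iff:
  assumes \<theta>: "0 < \<theta>" "\<theta> < 1"
  shows "w \<in> sturmian_language \<theta> \<longleftrightarrow> (\<exists>y. w = rot_word (\<theta> / (1 + \<theta>)) y (length w))"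
proof
  assume "w \<in> sturmian_language \<theta>"
  then obtain E0 p k where *: "line_of_slope \<theta> E0" "E0 \<inter> range lattice_point = {}" "staircase \<theta> E0 p"
    and w: "w = map (\<lambda>j. step_word p (k + int j)) [0..<length w]"
    unfolding sturmian_language_def by blast
  obtain y where "\<And>j. step_word p (k + int j) = rot_code (\<theta> / (1 + \<theta>)) y j"
    using staircase_word[OF \<theta>(1) *] by blast
  then show "\<exists>y. w = rot_word (\<theta> / (1 + \<theta>)) y (length w)" using w by (auto simp: rot_word_def)
next
  let ?\<alpha> = "\<theta> / (1 + \<theta>)"
  assume "\<exists>y. w = rot_word ?\<alpha> y (length w)"
  then obtain y where w: "w = rot_word ?\<alpha> y (length w)" by blast
  obtain y' where y': "\<forall>j\<le>length w. \<lfloor>y' + real j * ?\<alpha>\<rfloor> = \<lfloor>y + real j * ?\<alpha>\<rfloor>"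
    "\<And>i::int. y' + of_int i * ?\<alpha> \<notin> \<int>"
    using generic_perturbation[of "length w" ?\<alpha> y] by blast
  have "rot_word ?\<alpha> y' (length w) = w" using rot_word_cong[of "length w" y' ?\<alpha> y] y'(1) w by simp
  moreover obtain E0 p where "line_of_slope \<theta> E0" "E0 \<inter> range lattice_point = {}" "staircase \<theta> E0 p"
    "\<And>j. step_word p (int j) = rot_code ?\<alpha> y' j"
    using staircase_of_generic_rotation[OF \<theta> refl y'(2)] by blast
  ultimately show "w \<in> sturmian_language \<theta>"
    unfolding sturmian_language_def rot_word_def mem_Collect_eq
    by (intro exI[where x = E0] exI[where x = p] exI[where x = 0]) simp
qed

section \<open>Choice functions and the spectral distance\<close>

text \<open>The spectral estimates use only closure under subwords and extension to the right, so
  they are developed for an abstract language.\<close>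

definition language_shift :: "letter list set \<Rightarrow> (nat \<Rightarrow> letter) set" where
  "language_shift L = {\<xi>. \<forall>i n. map \<xi> [i..<i + n] \<in> L}"

definition right_special :: "letter list set \<Rightarrow> letter list \<Rightarrow> bool" where
  "right_special L w \<longleftrightarrow> w @ [LetterA] \<in> L \<and> w @ [LetterB] \<in> L"

definition extensible_language :: "letter list set \<Rightarrow> bool" where
  "extensible_language L \<longleftrightarrow>
     (\<forall>w\<in>L. \<forall>v. sublist v w \<longrightarrow> v \<in> L) \<and> (\<forall>w\<in>L. \<exists>a. w @ [a] \<in> L)"

lemma right_specialI:
  assumes "w @ [a] \<in> L" and "w @ [b] \<in> L" and "a \<noteq> b"
  shows "right_special L w"
  using assms unfolding right_special_def by (cases a; cases b) simp_all

lemma choice_functions_override: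
  assumes "extensible_language L" and "\<And>w. w \<in> S \<Longrightarrow> w @ [g w] \<in> L"
  shows "\<exists>c\<in>choice_functions L. \<forall>w\<in>S. c w = g w"
proof -
  define c where "c w = (if w \<in> S then g w else (SOME a. w @ [a] \<in> L))" for w
  have "w @ [c w] \<in> L" if "w \<in> L" for w
  proof (cases "w \<in> S")
    case False
    have "\<exists>a. w @ [a] \<in> L" using assms(1) that unfolding extensible_language_def by blast
    then show ?thesis using False someI_ex[of "\<lambda>a. w @ [a] \<in> L"] by (simp add: c_def)
  qed (simp add: c_def assms(2))
  then have "c \<in> choice_functions L" by (simp add: choice_functions_def)
  then show ?thesis by (intro bexI[of _ c]) (auto simp: c_def)
qed

section \<open>Sequences generated by a choice function\<close>

lemma extend_by_Suc: "extend_by c (Suc n) w = extend_by c n w @ [c (extend_by c n w)]"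
  by (simp add: extend_by_def)

lemma extend_by_0 [simp]: "extend_by c 0 w = w"
  by (simp add: extend_by_def)

lemma extend_by_Suc': "extend_by c (Suc n) w = extend_by c n (w @ [c w])"
  unfolding extend_by_def using funpow_swap1[of "\<lambda>w. w @ [c w]" n w] by simp

lemma length_extend_by [simp]: "length (extend_by c n w) = length w + n"
  by (induction n) (auto simp: extend_by_Suc)

lemma extend_by_nth:
  assumes "m \<le> n" and "i < length w + m"
  shows "extend_by c n w ! i = extend_by c m w ! i"
  using assms by (induction rule: dec_induct) (auto simp: extend_by_Suc nth_append)

lemma choice_seq_nth:
  assumes "i < length w + m"
  shows "choice_seq c w i = extend_by c m w ! i"
proof (cases "m \<le> Suc i")
  case True
  then show ?thesis using extend_by_nth[OF True assms] by (simp add: choice_seq_def)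
next
  case False
  then have "extend_by c m w ! i = extend_by c (Suc i) w ! i" by (intro extend_by_nth) auto
  then show ?thesis by (simp add: choice_seq_def)
qed

lemma choice_seq_prefix: "i < length w \<Longrightarrow> choice_seq c w i = w ! i"
  using choice_seq_nth[of i w 0 c] by simp

text \<open>The recursion from \<open>w\<close> passes through \<open>w @ [c w]\<close>. Along the
  prefixes of a sequence, the generated sequence therefore changes only where \<open>c\<close>
  leaves it.\<close>

lemma choice_seq_step: "choice_seq c (w @ [c w]) = choice_seq c w"
proof
  fix i
  have "choice_seq c w i = extend_by c (Suc (Suc i)) w ! i" by (rule choice_seq_nth) simp
  then show "choice_seq c (w @ [c w]) i = choice_seq c w i"
    by (simp only: extend_by_Suc' choice_seq_def)
qed

lemma extend_by_in_language:
  assumes "c \<in> choice_functions L" and "w \<in> L"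
  shows "extend_by c n w \<in> L"
  using assms by (induction n) (auto simp: extend_by_Suc choice_functions_def)

lemma choice_seq_in_shift:
  assumes L: "extensible_language L" and c: "c \<in> choice_functions L" and "w \<in> L"
  shows "choice_seq c w \<in> language_shift L"
proof -
  have "map (choice_seq c w) [i..<i + n] \<in> L" for i n
  proof -
    let ?u = "extend_by c (i + n) w"
    have "map (choice_seq c w) [i..<i + n] = take n (drop i ?u)"
      by (rule nth_equalityI) (auto simp: choice_seq_nth[where m = "i + n"])
    moreover have "sublist (take n (drop i ?u)) ?u"
      by (metis sublist_drop sublist_take sublist_order.order_trans)
    ultimately show ?thesis
      using L extend_by_in_language[OF c \<open>w \<in> L\<close>] unfolding extensible_language_def by metis
  qed
  then show ?thesis by (simp add: language_shift_def)
qed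

lemma shift_prefix_in_language: "x \<in> language_shift L \<Longrightarrow> map x [0..<n] \<in> L"
  unfolding language_shift_def by (metis (mono_tags, lifting) add_0 mem_Collect_eq)

section \<open>The commutator norm as a condition on edges\<close>

lemma edges_swap: "(v, u) \<in> edges L \<longleftrightarrow> (u, v) \<in> edges L"
  unfolding edges_def by auto

lemma commutator_apply:
  "commutator \<delta> c f \<psi> (u, v) =
     (f (choice_seq c v) - f (choice_seq c u)) * \<psi> (v, u) / of_real (edge_length \<delta> (u, v))"
  by (simp add: commutator_def dirac_op_def rep_op_def algebra_simps diff_divide_distrib)

lemma ell2_delta:
  assumes "e \<in> E"
  shows "(\<lambda>x. if x = e then z else 0) \<in> ell2 E" and "ell2_norm E (\<lambda>x. if x = e then z else 0) = cmod z"
proof -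
  let ?g = "\<lambda>x. (cmod (if x = e then z else 0))\<^sup>2"
  have "(?g has_sum (\<Sum>x\<in>{e}. ?g x)) {e}" by (rule has_sum_finite) simp
  then have s: "(?g has_sum (cmod z)\<^sup>2) E"
    using assms by (subst has_sum_cong_neutral[where T = "{e}" and g = ?g]) auto
  then show "(\<lambda>x. if x = e then z else 0) \<in> ell2 E"
    using assms by (auto simp: ell2_def summable_on_def)
  show "ell2_norm E (\<lambda>x. if x = e then z else 0) = cmod z"
    unfolding ell2_norm_def using infsumI[OF s] by simp
qed

text \<open>The commutator is the flip of edges, a permutation of the edge set, followed by
  multiplication with difference quotients. Square sums give one direction; the other tests basis
  vectors, which lie in the domain because the Dirac operator maps each to a multiple of
  another.\<close>

lemma commutator_norm_le_1_iff:
  assumes pos: "\<And>n. 0 < \<delta> n"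
  shows "commutator_norm_le_1 \<delta> (edges L) c f \<longleftrightarrow>
    (\<forall>(u, v)\<in>edges L. cmod (f (choice_seq c u) - f (choice_seq c v)) \<le> edge_length \<delta> (u, v))"
    (is "?lhs \<longleftrightarrow> ?rhs")
proof
  have l: "0 < edge_length \<delta> e" for e using pos by (simp add: edge_length_def)
  {
    assume lhs: ?lhs
    show ?rhs
    proof (clarify)
      fix u v
      assume e: "(u, v) \<in> edges L"
      then have e': "(v, u) \<in> edges L" by (simp add: edges_swap)
      define \<psi> :: "edge \<Rightarrow> complex" where "\<psi> = (\<lambda>x. if x = (v, u) then 1 else 0)"
      have D: "dirac_op \<delta> \<psi> = (\<lambda>x. if x = (u, v) then 1 / of_real (edge_length \<delta> (u, v)) else 0)"
        by (auto simp: dirac_op_def \<psi>_def fun_eq_iff)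
      have dom: "\<psi> \<in> dirac_domain \<delta> (edges L)"
        using ell2_delta(1)[OF e'] ell2_delta(1)[OF e] by (simp add: dirac_domain_def D) (simp add: \<psi>_def)
      let ?z = "(f (choice_seq c v) - f (choice_seq c u)) / of_real (edge_length \<delta> (u, v))"
      have "commutator \<delta> c f \<psi> = (\<lambda>x. if x = (u, v) then ?z else 0)"
      proof
        fix x
        show "commutator \<delta> c f \<psi> x = (if x = (u, v) then ?z else 0)"
          by (cases x) (auto simp: commutator_apply \<psi>_def)
      qed
      then have "ell2_norm (edges L) (commutator \<delta> c f \<psi>) = cmod ?z"
        using ell2_delta(2)[OF e] by simp
      moreover have "ell2_norm (edges L) \<psi> = 1"
        unfolding \<psi>_def using ell2_delta(2)[OF e', of 1] by simp
      ultimately have "cmod ?z \<le> 1"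
        using lhs dom unfolding commutator_norm_le_1_def by metis
      then show "cmod (f (choice_seq c u) - f (choice_seq c v)) \<le> edge_length \<delta> (u, v)"
        using l[of "(u, v)"] by (simp add: norm_divide norm_minus_commute)
    qed
  }
  {
    assume rhs: ?rhs
    show ?lhs unfolding commutator_norm_le_1_def
    proof
      fix \<psi>
      assume "\<psi> \<in> dirac_domain \<delta> (edges L)"
      then have \<psi>: "\<psi> \<in> ell2 (edges L)" by (simp add: dirac_domain_def)
      let ?g = "\<lambda>e. (cmod (\<psi> e))\<^sup>2" and ?h = "\<lambda>e. (cmod (commutator \<delta> c f \<psi> e))\<^sup>2"
      have bij: "bij_betw prod.swap (edges L) (edges L)"
        by (rule bij_betwI[where g = prod.swap]) (auto simp: edges_swap)
      have sg: "?g summable_on edges L" using \<psi> by (simp add: ell2_def)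
      then have sg': "(\<lambda>e. ?g (prod.swap e)) summable_on edges L"
        using summable_on_reindex_bij_betw[OF bij, of ?g] by simp
      have le: "?h e \<le> ?g (prod.swap e)" if "e \<in> edges L" for e
      proof -
        obtain u v where e: "e = (u, v)" by (cases e)
        let ?d = "f (choice_seq c v) - f (choice_seq c u)"
        have "cmod ?d \<le> edge_length \<delta> (u, v)"
          using rhs that unfolding e by (auto simp: norm_minus_commute)
        then have "cmod ?d / edge_length \<delta> (u, v) \<le> 1" using l[of "(u, v)"] by simp
        then have "(cmod ?d / edge_length \<delta> (u, v)) * cmod (\<psi> (v, u)) \<le> 1 * cmod (\<psi> (v, u))"
          by (rule mult_right_mono) simp
        then have "cmod (commutator \<delta> c f \<psi> e) \<le> cmod (\<psi> (prod.swap e))"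
          using l[of "(u, v)"] unfolding e by (simp add: commutator_apply norm_divide norm_mult)
        then show ?thesis by (intro power_mono) auto
      qed
      have sh: "?h summable_on edges L"
        by (rule summable_on_comparison_test[OF sg']) (use le in auto)
      have 0: "commutator \<delta> c f \<psi> e = 0" if "e \<notin> edges L" for e
      proof (cases e)
        case (Pair u v)
        then have "\<psi> (v, u) = 0" using that \<psi> by (auto simp: ell2_def edges_swap)
        then show ?thesis by (simp add: Pair commutator_apply)
      qed
      have "infsum ?h (edges L) \<le> infsum (\<lambda>e. ?g (prod.swap e)) (edges L)"
        by (rule infsum_mono[OF sh sg' le])
      also have "\<dots> = infsum ?g (edges L)" by (rule infsum_reindex_bij_betw[OF bij])
      finally have "ell2_norm (edges L) (commutator \<delta> c f \<psi>) \<le> ell2_norm (edges L) \<psi>"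
        by (simp add: ell2_norm_def)
      then show "commutator \<delta> c f \<psi> \<in> ell2 (edges L) \<and>
          ell2_norm (edges L) (commutator \<delta> c f \<psi>) \<le> ell2_norm (edges L) \<psi>"
        using sh 0 by (auto simp: ell2_def)
    qed
  }
qed

section \<open>Bounds along the prefixes of a sequence\<close>

lemma common_prefix_length_eqI:
  assumes "\<And>i. i < n \<Longrightarrow> x i = y i" and "x n \<noteq> y n"
  shows "common_prefix_length x y = n"
proof -
  have "x \<noteq> y" using assms(2) by auto
  then have "n \<le> common_prefix_length x y" and "\<not> Suc n \<le> common_prefix_length x y"
    using assms common_prefix_length_less_iff[of x y] by auto
  then show ?thesis by simp
qed

lemma common_prefix_length_props:
  assumes "x \<noteq> y"
  shows "\<And>i. i < common_prefix_length x y \<Longrightarrow> x i = y i"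
    and "x (common_prefix_length x y) \<noteq> y (common_prefix_length x y)"
proof -
  let ?m = "common_prefix_length x y"
  show *: "x i = y i" if "i < ?m" for i
    using common_prefix_length_less_iff[OF assms, of ?m] that by auto
  show "x ?m \<noteq> y ?m"
    using common_prefix_length_less_iff[OF assms, of "Suc ?m"] * by (auto simp: less_Suc_eq)
qed

lemma prefix_limit:
  fixes \<delta> :: "nat \<Rightarrow> real"
  assumes L: "extensible_language L" and c: "c \<in> choice_functions L"
    and pos: "\<And>n. 0 < \<delta> n" and dec: "\<And>m n. m < n \<Longrightarrow> \<delta> n < \<delta> m" and lim: "\<delta> \<longlonglongrightarrow> 0"
    and f: "f \<in> continuous_functions \<delta> (language_shift L)" and x: "x \<in> language_shift L"
  shows "(\<lambda>n. f (choice_seq c (map x [0..<n]))) \<longlonglongrightarrow> f x"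
proof -
  interpret Metric_space "language_shift L" "word_dist \<delta>"
    by (rule Metric_space_word_dist[OF pos dec])
  let ?x = "\<lambda>n. choice_seq c (map x [0..<n])"
  have in_shift: "?x n \<in> language_shift L" for n
    by (intro choice_seq_in_shift[OF L c] shift_prefix_in_language x)
  have "limitin mtopology ?x x sequentially"
    unfolding limit_metric_sequentially
  proof (intro conjI allI impI)
    fix \<epsilon> :: real
    assume "0 < \<epsilon>"
    then obtain N where N: "\<And>n. n \<ge> N \<Longrightarrow> \<delta> n < \<epsilon>"
      using order_tendstoD(2)[OF lim] unfolding eventually_sequentially by blast
    have "word_dist \<delta> (?x n) x < \<epsilon>" if "n \<ge> N" for n
    proof (cases "?x n = x")
      case True
      then show ?thesis using \<open>0 < \<epsilon>\<close> by (simp add: word_dist_def)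
    next
      case False
      have "n \<le> common_prefix_length (?x n) x"
        using common_prefix_length_less_iff[OF False] by (simp add: choice_seq_prefix)
      then show ?thesis using N that False by (simp add: word_dist_def)
    qed
    then show "\<exists>N. \<forall>n\<ge>N. ?x n \<in> language_shift L \<and> word_dist \<delta> (?x n) x < \<epsilon>"
      using in_shift by blast
  qed (rule x)
  moreover have "continuous_map mtopology euclidean f" using f by (simp add: continuous_functions_def)
  ultimately have "limitin euclidean (f \<circ> ?x) (f x) sequentially" by (intro continuous_map_limit)
  then show ?thesis by (simp add: o_def)
qed

lemma edge_bound:
  assumes pos: "\<And>n. 0 < \<delta> n" and f: "commutator_norm_le_1 \<delta> (edges L) c f"
    and "w @ [a] \<in> L" and "w @ [b] \<in> L"
  shows "cmod (f (choice_seq c (w @ [a])) - f (choice_seq c (w @ [b]))) \<le> \<delta> (length w)"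
proof (cases "a = b")
  case True
  then show ?thesis using pos[of "length w"] by simp
next
  case False
  then have "(w @ [a], w @ [b]) \<in> edges L" using assms by (auto simp: edges_def)
  then show ?thesis
    using f unfolding commutator_norm_le_1_iff[OF pos] by (fastforce simp: edge_length_def)
qed

text \<open>Since \<open>choice_seq c w = choice_seq c (w @ [c w])\<close>, passing from length
  \<open>n\<close> to \<open>Suc n\<close> compares \<open>w @ [c w]\<close> with
  \<open>w @ [x n]\<close>. These agree or form an edge, and an edge requires \<open>w\<close> to be
  right special.\<close>

lemma spectral_path_bound:
  assumes L: "extensible_language L" and c: "c \<in> choice_functions L"
    and pos: "\<And>n. 0 < \<delta> n" and f: "commutator_norm_le_1 \<delta> (edges L) c f"
    and x: "x \<in> language_shift L" and "k \<le> n"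
  shows "cmod (f (choice_seq c (map x [0..<n])) - f (choice_seq c (map x [0..<k])))
    \<le> (\<Sum>j | k \<le> j \<and> j < n \<and> right_special L (map x [0..<j]). \<delta> j)"
  using \<open>k \<le> n\<close>
proof (induction n rule: dec_induct)
  case base
  then show ?case by (simp add: sum_nonneg less_imp_le pos)
next
  case (step n)
  let ?R = "\<lambda>n. {j. k \<le> j \<and> j < n \<and> right_special L (map x [0..<j])}"
  let ?F = "\<lambda>n. f (choice_seq c (map x [0..<n]))"
  let ?w = "map x [0..<n]"
  have w: "?w @ [x n] \<in> L" "?w @ [c ?w] \<in> L"
    using shift_prefix_in_language[OF x, of "Suc n"] shift_prefix_in_language[OF x, of n] c
    by (auto simp: choice_functions_def)
  have fin: "finite (?R n)" for n by (rule finite_subset[of _ "{..<n}"]) auto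
  have "cmod (?F (Suc n) - ?F n) + (\<Sum>j\<in>?R n. \<delta> j) \<le> (\<Sum>j\<in>?R (Suc n). \<delta> j)"
  proof (cases "right_special L ?w")
    case True
    then have "?R (Suc n) = insert n (?R n)" using step.hyps by (auto simp: less_Suc_eq)
    moreover have "cmod (?F (Suc n) - ?F n) \<le> \<delta> n"
      using edge_bound[OF pos f w] by (simp add: choice_seq_step)
    ultimately show ?thesis using fin by simp
  next
    case False
    then have "x n = c ?w" using right_specialI[OF w] by blast
    then have "?F (Suc n) = ?F n" by (simp add: choice_seq_step)
    moreover have "?R (Suc n) = ?R n" using False by (auto simp: less_Suc_eq)
    ultimately show ?thesis by simp
  qed
  then show ?case
    using step.IH norm_triangle_ineq[of "?F (Suc n) - ?F n" "?F n - ?F k"] by simp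
qed

text \<open>The path runs from \<open>x\<close> down to its prefix of length \<open>Suc ?m\<close>,
  across one edge of length \<open>\<delta> ?m\<close>, and up to \<open>y\<close>. Starting both
  tails at \<open>Suc ?m\<close> keeps \<open>1 \<le> k\<close>, the range in which sums are assumed
  bounded.\<close>

lemma spectral_upper_bound:
  fixes \<delta> :: "nat \<Rightarrow> real"
  assumes L: "extensible_language L" and c: "c \<in> choice_functions L"
    and pos: "\<And>n. 0 < \<delta> n" and dec: "\<And>m n. m < n \<Longrightarrow> \<delta> n < \<delta> m" and lim: "\<delta> \<longlonglongrightarrow> 0"
    and f: "f \<in> continuous_functions \<delta> (language_shift L)" "commutator_norm_le_1 \<delta> (edges L) c f"
    and x: "x \<in> language_shift L" and y: "y \<in> language_shift L" and "x \<noteq> y"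
    and bound: "\<And>z k n. z \<in> language_shift L \<Longrightarrow> 1 \<le> k \<Longrightarrow>
      (\<Sum>j | k \<le> j \<and> j < n \<and> right_special L (map z [0..<j]). \<delta> j) \<le> B * \<delta> k"
  shows "cmod (f x - f y) \<le> (2 * B + 1) * word_dist \<delta> x y"
proof -
  let ?m = "common_prefix_length x y"
  note m = common_prefix_length_props[OF \<open>x \<noteq> y\<close>]
  let ?F = "\<lambda>z n. f (choice_seq c (map z [0..<n]))"
  have "0 \<le> B * \<delta> 1" using bound[OF x, of 1 0] by simp
  then have B: "0 \<le> B" using pos[of 1] by (simp add: zero_le_mult_iff)
  have tail: "cmod (f z - ?F z (Suc ?m)) \<le> B * \<delta> ?m" if z: "z \<in> language_shift L" for z
  proof (rule tendsto_upperbound)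
    show "(\<lambda>n. cmod (?F z n - ?F z (Suc ?m))) \<longlonglongrightarrow> cmod (f z - ?F z (Suc ?m))"
      by (intro tendsto_norm tendsto_diff tendsto_const prefix_limit[OF L c pos dec lim f(1) z])
    show "\<forall>\<^sub>F n in sequentially. cmod (?F z n - ?F z (Suc ?m)) \<le> B * \<delta> ?m"
      unfolding eventually_sequentially
    proof (intro exI[of _ "Suc ?m"] allI impI)
      fix n assume "Suc ?m \<le> n"
      have "cmod (?F z n - ?F z (Suc ?m)) \<le> B * \<delta> (Suc ?m)"
        by (rule order_trans[OF spectral_path_bound[OF L c pos f(2) z \<open>Suc ?m \<le> n\<close>] bound[OF z]]) simp
      also have "\<dots> \<le> B * \<delta> ?m" using B dec[of ?m "Suc ?m"] by (intro mult_left_mono) auto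
      finally show "cmod (?F z n - ?F z (Suc ?m)) \<le> B * \<delta> ?m" .
    qed
  qed simp
  have xm: "map x [0..<Suc ?m] = map x [0..<?m] @ [x ?m]" by simp
  have ym: "map y [0..<Suc ?m] = map x [0..<?m] @ [y ?m]" using m by simp
  have "cmod (?F x (Suc ?m) - ?F y (Suc ?m)) \<le> \<delta> (length (map x [0..<?m]))"
    unfolding xm ym
    by (intro edge_bound[OF pos f(2)])
      (use shift_prefix_in_language[OF x, of "Suc ?m"] shift_prefix_in_language[OF y, of "Suc ?m"] in
        \<open>simp_all only: xm ym\<close>)
  then have "cmod (f x - f y) \<le> B * \<delta> ?m + \<delta> ?m + B * \<delta> ?m"
    using tail[OF x] tail[OF y]
      norm_triangle_ineq[of "f x - ?F x (Suc ?m)" "?F x (Suc ?m) - ?F y (Suc ?m)"]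
      norm_triangle_ineq[of "f x - ?F y (Suc ?m)" "?F y (Suc ?m) - f y"]
    by (simp add: norm_minus_commute)
  then show ?thesis using \<open>x \<noteq> y\<close> by (simp add: word_dist_def algebra_simps)
qed

text \<open>Letting the choice function leave \<open>x\<close> at every length in \<open>S\<close> makes the jumps of the
  test function, one for each length in \<open>S\<close>, occur along different edges.\<close>

lemma spectral_lower_bound:
  fixes \<delta> :: "nat \<Rightarrow> real"
  assumes L: "extensible_language L"
    and pos: "\<And>n. 0 < \<delta> n" and dec: "\<And>m n. m < n \<Longrightarrow> \<delta> n < \<delta> m"
    and x: "x \<in> language_shift L" and y: "y \<in> language_shift L" and "x \<noteq> y"
    and S: "finite S" "\<And>n. n \<in> S \<Longrightarrow> common_prefix_length x y \<le> n"
      "\<And>n. n \<in> S \<Longrightarrow> right_special L (map x [0..<n])"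
  shows "\<exists>c\<in>choice_functions L. \<exists>f\<in>continuous_functions \<delta> (language_shift L).
    commutator_norm_le_1 \<delta> (edges L) c f \<and> cmod (f x - f y) = (\<Sum>n\<in>S. \<delta> n)"
proof -
  define other where "other a = (if a = LetterA then LetterB else LetterA)" for a
  define g where "g w = other (x (length w))" for w :: "letter list"
  have other: "other a \<noteq> a" for a by (cases a) (auto simp: other_def)
  have "w @ [a] \<in> L" if "w \<in> (\<lambda>n. map x [0..<n]) ` S" for w a
    using S(3) that by (cases a) (auto simp: right_special_def)
  then obtain c where c: "c \<in> choice_functions L" and cS: "\<forall>w\<in>(\<lambda>n. map x [0..<n]) ` S. c w = g w"
    using choice_functions_override[OF L, of "(\<lambda>n. map x [0..<n]) ` S" g] by blast
  have leave: "c (map x [0..<n]) \<noteq> x n" if "n \<in> S" for n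
    using cS that other[of "x n"] by (simp add: g_def)
  \<comment> \<open>Each \<open>n\<close> in \<open>S\<close> contributes a jump of
    \<open>\<delta> n\<close> between sequences that follow \<open>x\<close> through index
    \<open>n\<close> and those that leave it earlier. Being a finite sum, \<open>h\<close> depends
    on finitely many letters.\<close>
  define h where "h z = (\<Sum>n\<in>S. if \<forall>i\<le>n. z i = x i then \<delta> n else 0)" for z
  define f where "f z = complex_of_real (h z)" for z
  interpret Metric_space "language_shift L" "word_dist \<delta>"
    by (rule Metric_space_word_dist[OF pos dec])
  have local: "h z' = h z" if N: "\<And>n. n \<in> S \<Longrightarrow> n < N" and "word_dist \<delta> z z' < \<delta> N" for z z' N
  proof (cases "z = z'")
    case False
    have "N < common_prefix_length z z'"
    proof (rule ccontr)
      assume "\<not> ?thesis"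
      then have "\<delta> N \<le> \<delta> (common_prefix_length z z')"
        using dec[of "common_prefix_length z z'" N] by (cases "common_prefix_length z z' = N") auto
      then show False using that False by (simp add: word_dist_def)
    qed
    then have eq: "z' i = z i" if "i \<le> N" for i using common_prefix_length_props(1)[OF False, of i] that by simp
    have "(\<forall>i\<le>n. z' i = x i) \<longleftrightarrow> (\<forall>i\<le>n. z i = x i)" if "n \<in> S" for n
      using N[OF that] eq by auto
    then show ?thesis unfolding h_def by (intro sum.cong refl if_cong) auto
  qed simp
  have "continuous_map mtopology euclidean f"
    unfolding continuous_map_from_metric
  proof (intro conjI ballI allI impI)
    fix z U
    assume "openin euclidean U \<and> f z \<in> U"
    obtain N where "\<forall>n\<in>S. n < N" using S(1) finite_nat_set_iff_bounded by blast
    then have "f z' \<in> U" if "word_dist \<delta> z z' < \<delta> N" for z'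
      using local[of N z z'] that \<open>openin euclidean U \<and> f z \<in> U\<close> by (simp add: f_def)
    then show "\<exists>r>0. \<forall>z'. z' \<in> language_shift L \<and> word_dist \<delta> z z' < r \<longrightarrow> f z' \<in> U"
      using pos[of N] by blast
  qed auto
  moreover have "commutator_norm_le_1 \<delta> (edges L) c f"
    unfolding commutator_norm_le_1_iff[OF pos]
  proof (clarify)
    fix u v
    assume "(u, v) \<in> edges L"
    then obtain n where n: "length u = Suc n" "length v = Suc n" "take n u = take n v" "u \<noteq> v"
      by (auto simp: edges_def)
    have eqn: "u ! i = v ! i" if "i < n" for i
      using n that by (metis nth_take)
    have diff: "u ! n \<noteq> v ! n"
    proof
      assume "u ! n = v ! n"
      then have "u = v" using n eqn by (intro nth_equalityI) (auto simp: less_Suc_eq)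
      then show False using n by simp
    qed
    \<comment> \<open>At least one end of an edge leaves \<open>x\<close> at index \<open>n\<close>;
      call it \<open>u\<close>. Its terms from \<open>n\<close> on vanish, the terms below
      \<open>n\<close> agree, and those of \<open>v\<close> above \<open>n\<close> vanish by the
      choice of \<open>c\<close>, so only the term at \<open>n\<close> remains.\<close>
    have *: "\<bar>h (choice_seq c u) - h (choice_seq c v)\<bar> \<le> \<delta> n"
      if n: "length u = Suc n" "length v = Suc n" and eqn: "\<And>i. i < n \<Longrightarrow> u ! i = v ! i"
        and un: "u ! n \<noteq> x n" for u v
    proof -
      let ?u = "choice_seq c u" and ?v = "choice_seq c v"
      have pre: "?u i = u ! i" "?v i = v ! i" if "i \<le> n" for i
        using choice_seq_prefix that n by auto
      define t where "t z j = (if \<forall>i\<le>j. z i = x i then \<delta> j else 0)" for z j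
      have t0: "t ?u j = 0" if "n \<le> j" for j using that pre(1)[of n] un by (auto simp: t_def)
      have tlt: "t ?v j = t ?u j" if "j < n" for j using that pre eqn by (auto simp: t_def)
      have tn: "0 \<le> t ?v n" "t ?v n \<le> \<delta> n" using pos[of n] by (auto simp: t_def)
      have tgt: "t ?v j = 0" if "j \<in> S" "n < j" for j
      proof -
        \<comment> \<open>The letter at index \<open>j\<close> lies beyond \<open>v\<close> and is
          chosen by \<open>c\<close>. Agreement with \<open>x\<close> through \<open>j\<close> would
          mean that \<open>c\<close> follows \<open>x\<close> at length \<open>j\<close>, contrary
          to \<open>leave\<close>.\<close>
        have "\<not> (\<forall>i\<le>j. ?v i = x i)"
        proof
          assume a: "\<forall>i\<le>j. ?v i = x i"
          have "map ?v [0..<j] = extend_by c (j - Suc n) v"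
            by (rule nth_equalityI)
              (use n that in \<open>auto simp: choice_seq_nth[where m = "j - Suc n"]\<close>)
          moreover have "?v j = c (extend_by c (j - Suc n) v)"
            using choice_seq_nth[of j v "Suc (j - Suc n)" c] n that by (simp add: extend_by_Suc nth_append)
          moreover have "map ?v [0..<j] = map x [0..<j]" using a by simp
          ultimately have "c (map x [0..<j]) = x j" using a by simp
          then show False using leave that by blast
        qed
        then show ?thesis by (simp only: t_def if_False)
      qed
      have "h ?u - h ?v = (\<Sum>j\<in>S. t ?u j - t ?v j)" by (simp add: h_def t_def sum_subtractf)
      also have "\<dots> = (\<Sum>j\<in>S. if j = n then - t ?v n else 0)"
      proof (rule sum.cong[OF refl])
        fix j assume "j \<in> S"
        show "t ?u j - t ?v j = (if j = n then - t ?v n else 0)"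
        proof (cases j n rule: linorder_cases)
          case less
          then show ?thesis using tlt[of j] by simp
        next
          case equal
          then show ?thesis using t0[of n] by simp
        next
          case greater
          then show ?thesis using t0[of j] tgt[OF \<open>j \<in> S\<close>] by simp
        qed
      qed
      also have "\<dots> = (if n \<in> S then - t ?v n else 0)" using S(1) by simp
      finally show ?thesis using tn by simp
    qed
    have "\<bar>h (choice_seq c u) - h (choice_seq c v)\<bar> \<le> \<delta> n"
    proof (cases "u ! n = x n")
      case True
      then show ?thesis using *[OF n(2,1)] eqn diff by (metis abs_minus_commute)
    next
      case False
      then show ?thesis using *[OF n(1,2)] eqn by blast
    qed
    then have "cmod (f (choice_seq c u) - f (choice_seq c v)) \<le> \<delta> n"
      unfolding f_def of_real_diff[symmetric] norm_of_real .
    then show "cmod (f (choice_seq c u) - f (choice_seq c v)) \<le> edge_length \<delta> (u, v)"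
      using n by (simp add: edge_length_def)
  qed
  moreover have "cmod (f x - f y) = (\<Sum>n\<in>S. \<delta> n)"
  proof -
    have "\<not> (\<forall>i\<le>n. y i = x i)" if "n \<in> S" for n
      using common_prefix_length_props(2)[OF \<open>x \<noteq> y\<close>] S(2)[OF that] by metis
    then have "h y = 0" unfolding h_def by (intro sum.neutral) auto
    moreover have "h x = (\<Sum>n\<in>S. \<delta> n)" by (simp add: h_def)
    ultimately show ?thesis
      using pos unfolding f_def by (simp add: sum_nonneg less_imp_le del: of_real_sum)
  qed
  ultimately show ?thesis using c by (auto simp: continuous_functions_def)
qed

section \<open>Powers, recurrence and right special words\<close>

text \<open>The period can fail only if a shift by \<beta> crosses an integer at one of the times
  \<open>0, ..., m\<close>. Of the \<open>m + 2\<close> starting points with spacing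
  \<open>1 / (m + 2)\<close>, each time spoils at most one, since \<bar>\<beta>\<bar> does not
  exceed the spacing; some starting point survives all \<open>m + 1\<close> times.\<close>

lemma long_rotation_period:
  fixes p :: int and m q :: nat
  assumes "(real m + 2) * \<bar>real q * \<alpha> - of_int p\<bar> \<le> 1"
  shows "\<exists>y. \<forall>i<m. rot_code \<alpha> y (i + q) = rot_code \<alpha> y i"
proof -
  define \<beta> where "\<beta> = real q * \<alpha> - of_int p"
  define z where "z i j = real i / (real m + 2) + real j * \<alpha>" for i j :: nat
  have inj: "i = i'" if "i < m + 2" "i' < m + 2" and
    bad: "\<lfloor>z i j + \<beta>\<rfloor> \<noteq> \<lfloor>z i j\<rfloor>" "\<lfloor>z i' j + \<beta>\<rfloor> \<noteq> \<lfloor>z i' j\<rfloor>" for i i' j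
  proof -
    have "\<exists>k. \<bar>(z i j - z i' j) - of_int k\<bar> < \<bar>\<beta>\<bar>"
    proof (cases "0 \<le> \<beta>")
      case True
      then have "of_int \<lfloor>z i j + \<beta>\<rfloor> \<le> z i j + \<beta>" "z i j < of_int \<lfloor>z i j + \<beta>\<rfloor>"
        "of_int \<lfloor>z i' j + \<beta>\<rfloor> \<le> z i' j + \<beta>" "z i' j < of_int \<lfloor>z i' j + \<beta>\<rfloor>"
        using bad by linarith+
      then show ?thesis using True by (intro exI[of _ "\<lfloor>z i j + \<beta>\<rfloor> - \<lfloor>z i' j + \<beta>\<rfloor>"]) (simp, linarith)
    next
      case False
      then have "of_int \<lfloor>z i j\<rfloor> \<le> z i j" "z i j + \<beta> < of_int \<lfloor>z i j\<rfloor>"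
        "of_int \<lfloor>z i' j\<rfloor> \<le> z i' j" "z i' j + \<beta> < of_int \<lfloor>z i' j\<rfloor>"
        using bad by linarith+
      then show ?thesis using False by (intro exI[of _ "\<lfloor>z i j\<rfloor> - \<lfloor>z i' j\<rfloor>"]) (simp, linarith)
    qed
    then obtain k :: int where k: "\<bar>(z i j - z i' j) - of_int k\<bar> < \<bar>\<beta>\<bar>" by blast
    let ?d = "(int i - int i') - (int m + 2) * k"
    have "real m + 2 \<noteq> 0" by linarith
    then have "(z i j - z i' j) - of_int k = of_int ?d / (real m + 2)"
      by (simp add: z_def diff_divide_distrib)
    then have "\<bar>of_int ?d :: real\<bar> / (real m + 2) < \<bar>\<beta>\<bar>" using k by simp
    then have "\<bar>of_int ?d :: real\<bar> < (real m + 2) * \<bar>\<beta>\<bar>" by (simp add: divide_less_eq mult.commute)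
    then have "\<bar>of_int ?d :: real\<bar> < 1" using assms unfolding \<beta>_def by linarith
    then have "?d = 0" by linarith
    then have d: "int i - int i' = (int m + 2) * k" by simp
    have "\<bar>int i - int i'\<bar> < int m + 2" using that by linarith
    then have "\<bar>k\<bar> * (int m + 2) < 1 * (int m + 2)" unfolding d abs_mult by (simp add: mult.commute)
    then have "k = 0" by (subst (asm) mult_less_cancel_right) auto
    then show ?thesis using d by simp
  qed
  have "\<exists>i<m + 2. \<forall>j\<le>m. \<lfloor>z i j + \<beta>\<rfloor> = \<lfloor>z i j\<rfloor>"
  proof (rule ccontr)
    assume "\<not> ?thesis"
    then have "\<forall>i\<in>{..<m + 2}. \<exists>j. j \<le> m \<and> \<lfloor>z i j + \<beta>\<rfloor> \<noteq> \<lfloor>z i j\<rfloor>" by auto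
    then obtain g where g: "\<And>i. i < m + 2 \<Longrightarrow> g i \<le> m" "\<And>i. i < m + 2 \<Longrightarrow> \<lfloor>z i (g i) + \<beta>\<rfloor> \<noteq> \<lfloor>z i (g i)\<rfloor>"
      by (metis lessThan_iff)
    have "inj_on g {..<m + 2}"
    proof (rule inj_onI)
      fix i i' assume "i \<in> {..<m + 2}" "i' \<in> {..<m + 2}" "g i = g i'"
      then show "i = i'" using g(2)[of i] g(2)[of i'] inj[of i i' "g i"] by simp
    qed
    moreover have "g ` {..<m + 2} \<subseteq> {..m}" using g(1) by auto
    ultimately have "card {..<m + 2} \<le> card {..m}" by (intro card_inj_on_le) auto
    then show False by simp
  qed
  then obtain i where i: "\<And>j. j \<le> m \<Longrightarrow> \<lfloor>z i j + \<beta>\<rfloor> = \<lfloor>z i j\<rfloor>" by blast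
  let ?y = "real i / (real m + 2)"
  have fl: "\<lfloor>?y + real (j + q) * \<alpha>\<rfloor> = \<lfloor>?y + real j * \<alpha>\<rfloor> + p" if "j \<le> m" for j
  proof -
    have "?y + real (j + q) * \<alpha> = z i j + \<beta> + of_int p" by (simp add: z_def \<beta>_def algebra_simps)
    then have "\<lfloor>?y + real (j + q) * \<alpha>\<rfloor> = \<lfloor>z i j + \<beta>\<rfloor> + p" by (simp only: floor_add_int)
    then show ?thesis unfolding i[OF that] by (simp add: z_def)
  qed
  have "rot_code \<alpha> ?y (j + q) = rot_code \<alpha> ?y j" if "j < m" for j
    using fl[of j] fl[of "Suc j"] that unfolding rot_code_def by (simp del: of_nat_Suc)
  then show ?thesis by blast
qed

lemma long_powers:
  assumes "\<not> badly_approximable \<alpha>"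
  shows "\<exists>q y. 1 \<le> q \<and> (\<forall>i<K * q. rot_code \<alpha> y (i + q) = rot_code \<alpha> y i)"
proof -
  \<comment> \<open>This constant is chosen because
    \<open>K * q + 2 \<le> (K + 2) * q\<close>.\<close>
  have "0 < 1 / (real K + 2)" by simp
  then have "\<not> (\<forall>i::nat. i \<ge> 1 \<longrightarrow> (\<forall>j::int. (1 / (real K + 2)) / real i \<le> \<bar>real i * \<alpha> - of_int j\<bar>))"
    using assms unfolding badly_approximable_def by blast
  then obtain q :: nat and p :: int where q: "1 \<le> q"
    and le: "\<bar>real q * \<alpha> - of_int p\<bar> < (1 / (real K + 2)) / real q"
    by (auto simp: not_le)
  have "(real (K * q) + 2) * \<bar>real q * \<alpha> - of_int p\<bar> \<le> ((real K + 2) * real q) * ((1 / (real K + 2)) / real q)"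
    using le q by (intro mult_mono) (auto simp: algebra_simps)
  also have "\<dots> = 1"
  proof -
    have "real K + 2 \<noteq> 0" "real q \<noteq> 0" using q by linarith+
    then show ?thesis by simp
  qed
  finally show ?thesis using long_rotation_period q by blast
qed

lemma irrational_mult:
  fixes \<alpha> :: real
  assumes "\<alpha> \<notin> \<rat>" and "1 \<le> q"
  shows "real q * \<alpha> \<noteq> of_int p"
proof
  assume "real q * \<alpha> = of_int p"
  then have "\<alpha> = of_int p / of_nat q" using assms(2) by (simp add: field_simps)
  also have "\<dots> \<in> \<rat>" by simp
  finally show False using assms(1) by contradiction
qed

text \<open>If \<open>P\<close> letters \<open>LetterB\<close> occur per period, the drift
  \<open>N * (q * \<alpha> - P)\<close> stays bounded for all \<open>N\<close>, which forces
  \<open>q * \<alpha> = P\<close>.\<close>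

lemma rot_code_aperiodic:
  assumes \<alpha>: "0 < \<alpha>" "\<alpha> < 1" "\<alpha> \<notin> \<rat>" and q: "1 \<le> q"
  shows "\<exists>i. rot_code \<alpha> y (i + q) \<noteq> rot_code \<alpha> y i"
proof (rule ccontr)
  assume "\<not> ?thesis"
  then have per: "rot_code \<alpha> y (i + q) = rot_code \<alpha> y i" for i by simp
  define g where "g j = \<lfloor>y + real j * \<alpha>\<rfloor>" for j :: nat
  define P where "P = g q - g 0"
  have Suc: "g (Suc j) = (if rot_code \<alpha> y j = LetterA then g j else g j + 1)" for j
    unfolding g_def by (rule floor_Suc_mult[OF \<alpha>(1,2)])
  have add: "g (j + q) = g j + P" for j
    by (induction j) (auto simp: P_def Suc per)
  have mult: "g (N * q) = g 0 + int N * P" for N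
  proof (induction N)
    case (Suc N)
    then show ?case using add[of "N * q"] by (simp add: algebra_simps)
  qed simp
  have bound: "\<bar>real N * (real q * \<alpha> - of_int P)\<bar> < 1" for N
  proof -
    have "\<lfloor>y + real (N * q) * \<alpha>\<rfloor> = \<lfloor>y\<rfloor> + int N * P" using mult[of N] by (simp add: g_def)
    then have "of_int \<lfloor>y\<rfloor> + real N * of_int P \<le> y + real (N * q) * \<alpha>"
      "y + real (N * q) * \<alpha> < of_int \<lfloor>y\<rfloor> + real N * of_int P + 1"
      using floor_correct[of "y + real (N * q) * \<alpha>"] by simp_all
    moreover have "real N * (real q * \<alpha> - of_int P) = real (N * q) * \<alpha> - real N * of_int P"
      by (simp add: algebra_simps)
    ultimately show ?thesis by linarith
  qed
  have "0 < \<bar>real q * \<alpha> - of_int P\<bar>" using irrational_mult[OF \<alpha>(3) q, of P] by simp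
  then obtain N :: nat where "1 < real N * \<bar>real q * \<alpha> - of_int P\<bar>"
    using reals_Archimedean3 by blast
  then show False using bound[of N] by (simp add: abs_mult)
qed

section \<open>Orbits and cylinders of a badly approximable rotation\<close>

locale badly_approximable_rotation =
  fixes \<alpha> c :: real
  assumes \<alpha>: "0 < \<alpha>" "\<alpha> < 1" and c: "0 < c"
    and ba: "\<And>(i::nat) (j::int). i \<ge> 1 \<Longrightarrow> c / real i \<le> \<bar>real i * \<alpha> - of_int j\<bar>"
begin

lemma c_less_1: "c < 1"
  using ba[of 1 0] \<alpha> by simp

text \<open>A Dirichlet denominator \<open>q \<le> n\<close> satisfies \<open>c * n < q\<close>, and the first \<open>q\<close> points of the orbit are
  within \<open>1 / q\<close> of the multiples of \<open>1 / q\<close>.\<close>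

lemma orbit_gap:
  fixes n :: nat and y :: real
  assumes n: "1 \<le> n" and \<beta>: "\<beta> = \<alpha> \<or> \<beta> = - \<alpha>"
  shows "\<exists>j<n. \<exists>k::int. y < of_int k - real j * \<beta> \<and> of_int k - real j * \<beta> < y + 3 / (c * real n)"
proof -
  obtain h k :: int where hk: "coprime h k" "0 < k" "k \<le> int n" "\<bar>of_int k * \<beta> - of_int h\<bar> < 1 / real n"
    using Dirichlet_approx_coprime[of n \<beta>] n by auto
  have "c / real (nat k) \<le> \<bar>of_int k * \<beta> - of_int h\<bar>"
  proof -
    have "\<bar>of_int k * \<beta> - of_int h\<bar> = \<bar>real (nat k) * \<alpha> - of_int (if \<beta> = \<alpha> then h else - h)\<bar>"
      using \<beta> hk(2) by auto
    then show ?thesis using ba[of "nat k"] hk(2) by simp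
  qed
  then have "c / of_int k < 1 / real n" using hk by simp
  then have cn: "c * real n < of_int k" using hk(2) n by (simp add: field_simps)
  \<comment> \<open>Scaled by \<open>k\<close>, the point sought is \<open>t\<close> up to an error
    below 1. The summand 2 leaves room for that error on both sides, and the resulting window of
    length 3 explains the constant.\<close>
  define t where "t = \<lfloor>of_int k * y\<rfloor> + 2"
  obtain u v where uv: "u * h + v * k = 1" using hk(1) bezout_int[of h k] by (auto simp: coprime_iff_gcd_eq_1)
  \<comment> \<open>By the Bezout identity \<open>u\<close> inverts \<open>h\<close> modulo
    \<open>k\<close>, so this \<open>j\<close> makes \<open>j * h + t\<close> a multiple of
    \<open>k\<close>.\<close>
  define j where "j = (- t * u) mod k"
  have j: "0 \<le> j" "j < k" using hk(2) by (auto simp: j_def)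
  have "k dvd j * h + t"
  proof -
    obtain a where "j = - t * u - k * a" unfolding j_def by (metis minus_mult_div_eq_mod)
    then have "j * h + t = (- t * u - k * a) * h + t * (u * h + v * k)" unfolding uv by simp
    also have "\<dots> = k * (t * v - a * h)" by (simp add: algebra_simps)
    finally show ?thesis by simp
  qed
  then obtain l where l: "j * h + t = k * l" by blast
  have kpos: "(0::real) < of_int k" using hk(2) by simp
  have "of_int j * (of_int h - of_int k * \<beta>) + of_int t = of_int k * (of_int l - of_int j * \<beta>)"
    using arg_cong[OF l, of real_of_int] by (simp add: algebra_simps)
  moreover have "\<bar>of_int j * (of_int h - of_int k * \<beta>)\<bar> < 1"
  proof (cases "j = 0")
    case False
    have "\<bar>of_int j\<bar> * \<bar>of_int h - of_int k * \<beta>\<bar> < real n * (1 / real n)"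
      using j hk False by (intro mult_le_less_imp_less) (auto simp: abs_minus_commute)
    then show ?thesis using n by (simp add: abs_mult)
  qed simp
  moreover have "of_int k * y + 1 < of_int t" "of_int t \<le> of_int k * y + 2"
    unfolding t_def by linarith+
  ultimately have "of_int k * y < of_int k * (of_int l - of_int j * \<beta>)"
    "of_int k * (of_int l - of_int j * \<beta>) < of_int k * y + 3" by linarith+
  moreover have "of_int k * y + 3 = of_int k * (y + 3 / of_int k)" using hk(2) by (simp add: distrib_left)
  ultimately have "y < of_int l - of_int j * \<beta>" and "of_int l - of_int j * \<beta> < y + 3 / of_int k"
    by (metis mult_less_cancel_left_pos[OF kpos])+
  moreover have "3 / of_int k \<le> 3 / (c * real n)" using cn c n kpos by (intro divide_left_mono mult_pos_pos) auto
  moreover have "nat j < n" "real (nat j) = of_int j" using j hk(3) by auto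
  ultimately show ?thesis by (intro exI[of _ "nat j"] conjI exI[of _ l]) auto
qed

text \<open>The points \<open>k - j * \<alpha>\<close> with \<open>j \<le> n\<close> are where
  codings of length \<open>n\<close> can change. Two of them differ by
  \<open>(j - i) * \<alpha>\<close> up to an integer, with \<bar>j - i\<bar> at most
  \<open>n\<close>.\<close>

lemma points_separated:
  fixes i j n :: nat and k l :: int
  assumes "i \<le> n" "j \<le> n" "1 \<le> n" and ne: "of_int k - real i * \<alpha> \<noteq> of_int l - real j * \<alpha>"
  shows "c / real n \<le> \<bar>(of_int k - real i * \<alpha>) - (of_int l - real j * \<alpha>)\<bar>"
proof (cases "i = j")
  case True
  then have "k \<noteq> l" using ne by auto
  then have "(1::real) \<le> \<bar>of_int k - of_int l\<bar>" by linarith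
  moreover have "c / real n \<le> 1" using c_less_1 \<open>1 \<le> n\<close> by (simp add: field_simps)
  ultimately show ?thesis using True by simp
next
  case False
  have *: "c / real n \<le> \<bar>real (j - i) * \<alpha> - of_int (l - k)\<bar>" if "i < j" "j \<le> n" for i j :: nat and k l
  proof -
    have "c / real n \<le> c / real (j - i)" using that c by (intro divide_left_mono) auto
    also have "\<dots> \<le> \<bar>real (j - i) * \<alpha> - of_int (l - k)\<bar>" using that by (intro ba) auto
    finally show ?thesis .
  qed
  show ?thesis
  proof (cases "i < j")
    case True
    then show ?thesis using *[of i j l k] assms by (simp add: of_nat_diff algebra_simps)
  next
    case False
    then show ?thesis using *[of j i k l] assms \<open>i \<noteq> j\<close>
      by (subst abs_minus_commute) (simp add: of_nat_diff algebra_simps)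
  qed
qed

text \<open>Discontinuities are at least \<open>c / n\<close> apart, so they cannot occur within
  half that distance on both sides of \<open>s\<close>; the free side supplies the interval.\<close>

lemma cylinder_interval:
  assumes n: "1 \<le> n"
  shows "\<exists>l. \<forall>t. l < t \<and> t < l + c / (2 * real n) \<longrightarrow> rot_word \<alpha> t n = rot_word \<alpha> s n"
proof -
  let ?b = "c / (2 * real n)"
  have b: "0 < ?b" "2 * ?b = c / real n" using c n by auto
  have const: "rot_word \<alpha> t n = rot_word \<alpha> s n"
    if free: "\<And>j k. j \<le> n \<Longrightarrow> \<not> (min s t < of_int k - real j * \<alpha> \<and> of_int k - real j * \<alpha> \<le> max s t)" for t
  proof (rule rot_word_cong)
    fix j assume "j \<le> n"
    have "\<lfloor>max s t + real j * \<alpha>\<rfloor> = \<lfloor>min s t + real j * \<alpha>\<rfloor>"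
      using free[OF \<open>j \<le> n\<close>, of "\<lfloor>max s t + real j * \<alpha>\<rfloor>"] floor_mono[of "min s t + real j * \<alpha>" "max s t + real j * \<alpha>"]
      by linarith
    then show "\<lfloor>t + real j * \<alpha>\<rfloor> = \<lfloor>s + real j * \<alpha>\<rfloor>" by (auto simp: max_def min_def split: if_splits)
  qed
  show ?thesis
  proof (cases "\<exists>j\<le>n. \<exists>k::int. s < of_int k - real j * \<alpha> \<and> of_int k - real j * \<alpha> < s + ?b")
    case False
    show ?thesis
    proof (intro exI[of _ s] allI impI const)
      fix t j and k :: int assume "s < t \<and> t < s + ?b" "j \<le> n"
      then show "\<not> (min s t < of_int k - real j * \<alpha> \<and> of_int k - real j * \<alpha> \<le> max s t)"
        using False by force
    qed
  next
    case True
    then obtain i and k :: int where i: "i \<le> n" "s < of_int k - real i * \<alpha>" "of_int k - real i * \<alpha> < s + ?b" by blast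
    show ?thesis
    proof (intro exI[of _ "s - ?b"] allI impI const notI)
      fix t j and l :: int
      assume t: "s - ?b < t \<and> t < s - ?b + ?b" and "j \<le> n"
        and "min s t < of_int l - real j * \<alpha> \<and> of_int l - real j * \<alpha> \<le> max s t"
      then have l: "t < of_int l - real j * \<alpha>" "of_int l - real j * \<alpha> \<le> s" by auto
      have "c / real n \<le> \<bar>(of_int k - real i * \<alpha>) - (of_int l - real j * \<alpha>)\<bar>"
        by (rule points_separated) (use i l \<open>j \<le> n\<close> n in auto)
      then show False using l i t b by linarith
    qed
  qed
qed

text \<open>The cylinder contains an interval of length \<open>c / (2 * n)\<close>, and
  \<open>N \<ge> 6 * n / c^2\<close> orbit points meet every interval of length
  \<open>3 / (c * N) \<le> c / (2 * n)\<close>. Rounding \<open>N\<close> up and the word itself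
  cost at most another \<open>2 * n\<close>.\<close>

lemma word_occurs:
  assumes n: "1 \<le> n" and m: "(6 / c\<^sup>2 + 2) * real n \<le> real m"
  shows "sublist (rot_word \<alpha> s n) (rot_word \<alpha> y m)"
proof -
  obtain l where l: "\<And>t. l < t \<Longrightarrow> t < l + c / (2 * real n) \<Longrightarrow> rot_word \<alpha> t n = rot_word \<alpha> s n"
    using cylinder_interval[OF n] by blast
  define N where "N = nat \<lceil>6 * real n / c\<^sup>2\<rceil>"
  have N: "6 * real n / c\<^sup>2 \<le> real N" "real N < 6 * real n / c\<^sup>2 + 1"
    using n c by (auto simp: N_def) linarith
  have "0 < 6 * real n / c\<^sup>2" using n c by simp
  then have N1: "1 \<le> N" using N by linarith
  obtain i k where i: "i < N" "l - y < of_int k - real i * (- \<alpha>)" "of_int k - real i * (- \<alpha>) < l - y + 3 / (c * real N)"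
    using orbit_gap[OF N1, of "- \<alpha>" "l - y"] by blast
  have "6 * real n \<le> c\<^sup>2 * real N" using N(1) c by (simp add: field_simps)
  then have "3 / (c * real N) \<le> c / (2 * real n)"
    using c n N1 by (simp add: field_simps power2_eq_square)
  then have "rot_word \<alpha> (y + real i * \<alpha> + of_int k) n = rot_word \<alpha> s n"
    using i by (intro l) (auto simp: algebra_simps)
  then have w: "rot_word \<alpha> (y + real i * \<alpha>) n = rot_word \<alpha> s n" by (simp add: rot_word_add_int)
  have "real (i + n) \<le> real m" using i(1) N(2) m n by (simp add: algebra_simps)
  then have im: "i + n \<le> m" by linarith
  have "rot_word \<alpha> (y + real i * \<alpha>) n = take n (drop i (rot_word \<alpha> y m))"
    by (rule nth_equalityI) (use im in \<open>auto simp: rot_code_shift\<close>)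
  then show ?thesis unfolding w[symmetric] by (metis sublist_drop sublist_take sublist_order.order_trans)
qed

end

text \<open>Two points of the unit interval that code \<open>w\<close> but continue differently
  enclose a point whose orbit hits an integer at time \<open>Suc (length w)\<close>. Floors are
  monotone, so that point codes \<open>w\<close> as well.\<close>

lemma right_special_rotation_point:
  assumes \<theta>: "0 < \<theta>" "\<theta> < 1" and \<alpha>_def: "\<alpha> = \<theta> / (1 + \<theta>)"
    and "right_special (sturmian_language \<theta>) w"
  shows "\<exists>k::int. \<exists>s. 0 \<le> s \<and> s < 1 \<and> s = of_int k - real (Suc (length w)) * \<alpha> \<and> w = rot_word \<alpha> s (length w)"
proof -
  have \<alpha>: "0 < \<alpha>" "\<alpha> < 1" using \<theta> by (auto simp: \<alpha>_def)
  let ?n = "length w"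
  have rep: "\<exists>y. 0 \<le> y \<and> y < 1 \<and> w = rot_word \<alpha> y ?n \<and> rot_code \<alpha> y ?n = a" if aw: "w @ [a] \<in> sturmian_language \<theta>" for a
  proof -
    obtain y where "w @ [a] = rot_word \<alpha> y (Suc ?n)"
      using aw unfolding sturmian_language_iff[OF \<theta>] \<alpha>_def[symmetric] by auto
    then have "w @ [a] = rot_word \<alpha> (frac y) (Suc ?n)"
      using rot_word_add_int[of \<alpha> "frac y" "\<lfloor>y\<rfloor>"] by (simp add: frac_def)
    then show ?thesis using frac_lt_1[of y] frac_ge_0[of y] by (intro exI[of _ "frac y"]) (simp add: rot_word_Suc)
  qed
  obtain y where y: "0 \<le> y" "y < 1" "w = rot_word \<alpha> y ?n" "rot_code \<alpha> y ?n = LetterA"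
    using rep assms(4) by (auto simp: right_special_def)
  obtain y' where y': "0 \<le> y'" "y' < 1" "w = rot_word \<alpha> y' ?n" "rot_code \<alpha> y' ?n = LetterB"
    using rep assms(4) by (fastforce simp: right_special_def)
  have "\<lfloor>y\<rfloor> = \<lfloor>y'\<rfloor>" using y(1,2) y'(1,2) by (simp add: floor_unique[of 0])
  then have eq: "\<lfloor>y + real j * \<alpha>\<rfloor> = \<lfloor>y' + real j * \<alpha>\<rfloor>" if "j \<le> ?n" for j
    using rot_word_floors[OF \<alpha> _ _ that, of y y'] y y' by simp
  define k where "k = \<lfloor>y' + real (Suc ?n) * \<alpha>\<rfloor>"
  define s where "s = of_int k - real (Suc ?n) * \<alpha>"
  have "\<lfloor>y + real (Suc ?n) * \<alpha>\<rfloor> < k"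
    using eq[of ?n] y(4) y'(4) unfolding k_def floor_Suc_mult[OF \<alpha>] by simp
  then have s: "y < s" "s \<le> y'" unfolding s_def k_def by linarith+
  have "rot_word \<alpha> s ?n = rot_word \<alpha> y ?n"
  proof (rule rot_word_cong)
    fix j assume "j \<le> ?n"
    have "\<lfloor>y + real j * \<alpha>\<rfloor> \<le> \<lfloor>s + real j * \<alpha>\<rfloor>" "\<lfloor>s + real j * \<alpha>\<rfloor> \<le> \<lfloor>y' + real j * \<alpha>\<rfloor>"
      using s by (auto intro!: floor_mono)
    then show "\<lfloor>s + real j * \<alpha>\<rfloor> = \<lfloor>y + real j * \<alpha>\<rfloor>" using eq[OF \<open>j \<le> ?n\<close>] by linarith
  qed
  then show ?thesis using s y y' by (intro exI[of _ k] exI[of _ s]) (auto simp: s_def)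
qed

text \<open>Both rotation points lie in one cylinder of length \<open>n\<close>, hence within
  \<open>3 / (c * n)\<close> of each other, while they differ by \<open>(n' - n) * \<alpha>\<close>
  modulo 1, which is at least \<open>c / (n' - n)\<close>.\<close>

lemma (in badly_approximable_rotation) right_special_prefix_gap:
  assumes \<theta>: "0 < \<theta>" "\<theta> < 1" and \<alpha>_def: "\<alpha> = \<theta> / (1 + \<theta>)"
    and "right_special (sturmian_language \<theta>) (map x [0..<n])"
    and "right_special (sturmian_language \<theta>) (map x [0..<n'])"
    and n: "1 \<le> n" "n < n'"
  shows "c\<^sup>2 / 3 * real n \<le> real n' - real n"
proof -
  obtain k s where s: "0 \<le> s" "s < 1" "s = of_int k - real (Suc n) * \<alpha>" "map x [0..<n] = rot_word \<alpha> s n"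
    using right_special_rotation_point[OF \<theta> \<alpha>_def assms(4)] by auto
  obtain k' s' where s': "0 \<le> s'" "s' < 1" "s' = of_int k' - real (Suc n') * \<alpha>" "map x [0..<n'] = rot_word \<alpha> s' n'"
    using right_special_rotation_point[OF \<theta> \<alpha>_def assms(5)] by auto
  have "rot_word \<alpha> s' n = take n (rot_word \<alpha> s' n')" using n by (simp add: rot_word_def take_map)
  also have "\<dots> = map x [0..<n]" using n unfolding s'(4)[symmetric] by (simp add: take_map)
  finally have eq: "rot_word \<alpha> s' n = rot_word \<alpha> s n" using s(4) by simp
  have close: "t' < t + 3 / (c * real n)"
    if "0 \<le> t" "t' < 1" "t \<le> t'" "rot_word \<alpha> t n = rot_word \<alpha> t' n" for t t'
  proof (rule ccontr)
    assume far: "\<not> ?thesis"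
    obtain j k where j: "j < n" "t < of_int k - real j * \<alpha>" "of_int k - real j * \<alpha> < t + 3 / (c * real n)"
      using orbit_gap[OF n(1), of \<alpha> t] by blast
    have "\<lfloor>t\<rfloor> = \<lfloor>t'\<rfloor>" using that(1-3) by (simp add: floor_unique[of 0])
    then have "\<lfloor>t + real j * \<alpha>\<rfloor> = \<lfloor>t' + real j * \<alpha>\<rfloor>"
      using rot_word_floors[OF \<alpha> that(4)] j by simp
    moreover have "\<lfloor>t + real j * \<alpha>\<rfloor> < k" "k \<le> \<lfloor>t' + real j * \<alpha>\<rfloor>"
      using j far by (auto simp: floor_less_iff le_floor_iff)
    ultimately show False by linarith
  qed
  have "\<bar>s' - s\<bar> < 3 / (c * real n)"
  proof (cases "s \<le> s'")
    case True
    then show ?thesis using close[OF s(1) s'(2) True] eq by simp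
  next
    case False
    then show ?thesis using close[OF s'(1) s(2)] eq by simp
  qed
  moreover have "c / real (n' - n) \<le> \<bar>s' - s\<bar>"
  proof -
    have "\<bar>s' - s\<bar> = \<bar>real (n' - n) * \<alpha> - of_int (k' - k)\<bar>"
      unfolding s(3) s'(3) using n by (subst abs_minus_commute) (simp add: of_nat_diff algebra_simps)
    then show ?thesis using ba[of "n' - n" "k' - k"] n by simp
  qed
  ultimately have "c / real (n' - n) < 3 / (c * real n)" by (rule order.strict_trans1[rotated])
  then have "c * (c * real n) < 3 * real (n' - n)" using c n by (simp add: field_simps)
  then show ?thesis using n by (simp add: power2_eq_square of_nat_diff)
qed

section \<open>Linear recurrence and bad approximability\<close>

lemma badly_approximable_rotationI:
  assumes "0 < \<alpha>" "\<alpha> < 1" "badly_approximable \<alpha>"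
  obtains c where "badly_approximable_rotation \<alpha> c"
  using assms unfolding badly_approximable_def badly_approximable_rotation_def by blast

lemma extensible_sturmian_language:
  assumes \<theta>: "0 < \<theta>" "\<theta> < 1"
  shows "extensible_language (sturmian_language \<theta>)"
  unfolding extensible_language_def sturmian_language_iff[OF \<theta>]
proof (intro conjI ballI allI impI)
  let ?\<alpha> = "\<theta> / (1 + \<theta>)"
  fix w assume "w \<in> sturmian_language \<theta>"
  then obtain y where y: "w = rot_word ?\<alpha> y (length w)" unfolding sturmian_language_iff[OF \<theta>] by blast
  show "\<exists>a y. w @ [a] = rot_word ?\<alpha> y (length (w @ [a]))"
    using y rot_word_Suc[of ?\<alpha> y "length w"] by (metis length_append_singleton)
  fix v assume "sublist v w"
  then obtain ps ss where w: "w = ps @ v @ ss" unfolding sublist_def by blast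
  have "v = rot_word ?\<alpha> (y + real (length ps) * ?\<alpha>) (length v)"
  proof (rule nth_equalityI)
    fix i assume i: "i < length v"
    then have "v ! i = w ! (length ps + i)" by (simp add: w nth_append)
    also have "\<dots> = rot_code ?\<alpha> y (length ps + i)" using i y nth_rot_word[of "length ps + i" "length w" ?\<alpha> y] by (simp add: w)
    finally show "v ! i = rot_word ?\<alpha> (y + real (length ps) * ?\<alpha>) (length v) ! i" using i by (simp only: nth_rot_word rot_code_shift)
  qed simp
  then show "\<exists>y. v = rot_word ?\<alpha> y (length v)" by blast
qed

lemma rot_word_in_language:
  assumes \<theta>: "0 < \<theta>" "\<theta> < 1"
  shows "rot_word (\<theta> / (1 + \<theta>)) y n \<in> sturmian_language \<theta>"
  unfolding sturmian_language_iff[OF \<theta>] by (intro exI[of _ y]) simp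

lemma irrational_rotation_number:
  fixes \<theta> :: real
  assumes "0 < \<theta>" and "\<theta> \<notin> \<rat>"
  shows "\<theta> / (1 + \<theta>) \<notin> \<rat>"
proof
  let ?\<alpha> = "\<theta> / (1 + \<theta>)"
  assume *: "?\<alpha> \<in> \<rat>"
  have "?\<alpha> / (1 - ?\<alpha>) \<in> \<rat>" by (rule Rats_divide[OF * Rats_diff[OF Rats_1 *]])
  moreover have "?\<alpha> / (1 - ?\<alpha>) = \<theta>" using assms(1) by (simp add: field_simps)
  ultimately show False using assms(2) by simp
qed

lemma linearly_recurrent_iff_badly_approximable:
  assumes \<theta>: "0 < \<theta>" "\<theta> < 1" "\<theta> \<notin> \<rat>"
  shows "linearly_recurrent (sturmian_language \<theta>) \<longleftrightarrow> badly_approximable (\<theta> / (1 + \<theta>))"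
proof
  let ?\<alpha> = "\<theta> / (1 + \<theta>)"
  have \<alpha>: "0 < ?\<alpha>" "?\<alpha> < 1" "?\<alpha> \<notin> \<rat>" using \<theta> irrational_rotation_number by auto
  {
    assume "badly_approximable ?\<alpha>"
    then obtain c where "badly_approximable_rotation ?\<alpha> c"
      using badly_approximable_rotationI[OF \<alpha>(1,2)] by blast
    then interpret badly_approximable_rotation ?\<alpha> c .
    show "linearly_recurrent (sturmian_language \<theta>)" unfolding linearly_recurrent_def
    proof (intro exI[of _ "6 / c\<^sup>2 + 2"] conjI allI impI ballI)
      show "0 < 6 / c\<^sup>2 + 2" by (rule add_nonneg_pos) auto
      fix n :: nat and w v
      assume "1 \<le> n" "w \<in> sturmian_language \<theta>" "(6 / c\<^sup>2 + 2) * real n \<le> real (length w)"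
        "v \<in> sturmian_language \<theta>" "length v = n"
      then show "sublist v w" unfolding sturmian_language_iff[OF \<theta>(1,2)]
        using word_occurs by metis
    qed
  }
  {
    assume "linearly_recurrent (sturmian_language \<theta>)"
    then obtain C :: real where C: "0 < C" and lr: "\<And>n w v. 1 \<le> n \<Longrightarrow> w \<in> sturmian_language \<theta> \<Longrightarrow>
        C * real n \<le> real (length w) \<Longrightarrow> v \<in> sturmian_language \<theta> \<Longrightarrow> length v = n \<Longrightarrow> sublist v w"
      unfolding linearly_recurrent_def by blast
    show "badly_approximable ?\<alpha>"
    proof (rule ccontr)
      assume "\<not> ?thesis"
      \<comment> \<open>The factor 2 absorbs \<open>q + 1 \<le> 2 * q\<close>.\<close>
      moreover obtain K :: nat where K: "2 * C \<le> real K" using real_arch_simple by blast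
      ultimately obtain q y where q: "1 \<le> q" and per: "\<And>i. i < K * q \<Longrightarrow> rot_code ?\<alpha> y (i + q) = rot_code ?\<alpha> y i"
        using long_powers by blast
      let ?w = "rot_word ?\<alpha> y (K * q + q)"
      obtain i where i: "rot_code ?\<alpha> y (i + q) \<noteq> rot_code ?\<alpha> y i"
        using rot_code_aperiodic[OF \<alpha> q] by blast
      \<comment> \<open>The first and last letters of this word differ, which is impossible inside a
        word of period \<open>q\<close>.\<close>
      let ?v = "rot_word ?\<alpha> (y + real i * ?\<alpha>) (q + 1)"
      have "C * real (q + 1) \<le> C * (2 * real q)" using q C by (intro mult_left_mono) auto
      also have "\<dots> \<le> real K * real q" using K mult_right_mono[OF K, of "real q"] by (simp add: mult_ac)
      finally have "C * real (q + 1) \<le> real (length ?w)" by simp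
      then have "sublist ?v ?w"
        by (intro lr[of "q + 1"] rot_word_in_language[OF \<theta>(1,2)]) simp_all
      then obtain ps ss where w: "?w = ps @ ?v @ ss" unfolding sublist_def by blast
      have len: "length ps + q < K * q + q" using arg_cong[OF w, of length] by simp
      have "?v ! t = ?w ! (length ps + t)" if "t < q + 1" for t
        using that by (simp only: w) (simp add: nth_append)
      then have v: "rot_code ?\<alpha> y (i + t) = rot_code ?\<alpha> y (length ps + t)" if "t \<le> q" for t
        using that len by (simp add: rot_code_shift del: times_divide_eq_right)
      have "rot_code ?\<alpha> y (i + q) = rot_code ?\<alpha> y (i + 0)"
        using per[of "length ps"] v[of 0] v[of q] len by simp
      then show False using i by simp
    qed
  }
qed

section \<open>Comparison of the spectral distance with the word metric\<close>

lemma language_shift_sturmian: "language_shift (sturmian_language \<theta>) = sturmian_subshift \<theta>"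
  by (simp add: language_shift_def sturmian_subshift_def)

section \<open>Sums over lacunary sets of lengths\<close>

lemma card_separated:
  fixes A :: "nat set" and \<epsilon> :: real
  assumes \<epsilon>: "0 < \<epsilon>" and sep: "\<And>m n. m \<in> A \<Longrightarrow> n \<in> A \<Longrightarrow> m < n \<Longrightarrow> \<epsilon> \<le> real n - real m"
    and bound: "\<And>n. n \<in> A \<Longrightarrow> real n < b"
  shows "card A \<le> nat \<lfloor>b / \<epsilon>\<rfloor> + 1"
proof -
  let ?g = "\<lambda>n. nat \<lfloor>real n / \<epsilon>\<rfloor>"
  have less: "?g m < ?g n" if "m \<in> A" "n \<in> A" "m < n" for m n
  proof -
    have "(real m + \<epsilon>) / \<epsilon> \<le> real n / \<epsilon>" using sep[OF that] \<epsilon> by (intro divide_right_mono) auto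
    then have "real m / \<epsilon> + 1 \<le> real n / \<epsilon>" using \<epsilon> by (simp add: add_divide_distrib)
    then have "\<lfloor>real m / \<epsilon>\<rfloor> + 1 \<le> \<lfloor>real n / \<epsilon>\<rfloor>" by linarith
    moreover have "0 \<le> \<lfloor>real m / \<epsilon>\<rfloor>" using \<epsilon> by simp
    ultimately show ?thesis by linarith
  qed
  have "inj_on ?g A"
  proof (rule inj_onI)
    fix m n assume "m \<in> A" "n \<in> A" "?g m = ?g n"
    then show "m = n" using less[of m n] less[of n m] by (cases m n rule: linorder_cases) simp_all
  qed
  moreover have "?g ` A \<subseteq> {..nat \<lfloor>b / \<epsilon>\<rfloor>}"
  proof (rule image_subsetI)
    fix n assume "n \<in> A"
    then have "real n / \<epsilon> \<le> b / \<epsilon>" using bound[of n] \<epsilon> by (intro divide_right_mono) simp_all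
    then show "?g n \<in> {..nat \<lfloor>b / \<epsilon>\<rfloor>}" by (simp add: nat_mono floor_mono)
  qed
  ultimately have "card A \<le> card {..nat \<lfloor>b / \<epsilon>\<rfloor>}" by (intro card_inj_on_le) auto
  then show ?thesis by simp
qed

text \<open>For a fixed \<open>N\<close> with \<open>c2 * \<delta> N < 1 / 2\<close>, multiplying a
  length by \<open>N\<close> at least halves \<delta>. Each window from \<open>k'\<close> to
  \<open>N * k'\<close> holds at most \<open>J\<close> elements of \<open>S\<close>, so the windows
  sum to at most \<open>J * (1 + 1 / 2 + 1 / 4 + ...)\<close> times the first value.\<close>

lemma lacunary_sum_bound:
  fixes \<delta> :: "nat \<Rightarrow> real" and c2 \<epsilon> :: real
  assumes pos: "\<And>n. 0 < \<delta> n" and dec: "\<And>m n. m < n \<Longrightarrow> \<delta> n < \<delta> m" and lim: "\<delta> \<longlonglongrightarrow> 0"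
    and c2: "0 < c2" "\<And>n m. n \<ge> 1 \<Longrightarrow> m \<ge> 1 \<Longrightarrow> \<delta> (n * m) \<le> c2 * \<delta> n * \<delta> m"
    and \<epsilon>: "0 < \<epsilon>"
  shows "\<exists>B. \<forall>k S. 1 \<le> k \<longrightarrow> finite S \<longrightarrow> (\<forall>n\<in>S. k \<le> n) \<longrightarrow>
    (\<forall>m\<in>S. \<forall>n\<in>S. m < n \<longrightarrow> \<epsilon> * real m \<le> real n - real m) \<longrightarrow> (\<Sum>n\<in>S. \<delta> n) \<le> B * \<delta> k"
proof -
  have mono: "\<delta> n \<le> \<delta> m" if "m \<le> n" for m n
    using dec[of m n] that by (cases "m = n") auto
  have "\<forall>\<^sub>F n in sequentially. \<delta> n < 1 / (2 * c2)"
    using c2(1) by (intro order_tendstoD(2)[OF lim]) simp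
  then obtain N0 where "\<And>n. N0 \<le> n \<Longrightarrow> \<delta> n < 1 / (2 * c2)" unfolding eventually_sequentially by blast
  then have "\<delta> (max 2 N0) < 1 / (2 * c2)" by simp
  then obtain N :: nat where N: "2 \<le> N" "\<delta> N < 1 / (2 * c2)" by (rule that[rotated]) simp
  define J where "J = real (nat \<lfloor>real N / \<epsilon>\<rfloor> + 1)"
  have J: "0 \<le> J" by (simp add: J_def)
  have half: "\<delta> (N * k) \<le> \<delta> k / 2" if "1 \<le> k" for k
  proof -
    have "\<delta> (N * k) \<le> (c2 * \<delta> N) * \<delta> k" using c2(2)[of N k] that N by simp
    also have "\<dots> \<le> (1 / 2) * \<delta> k"
      using N(2) c2(1) pos[of k] by (intro mult_right_mono) (auto simp: field_simps)
    finally show ?thesis by simp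
  qed
  have "(\<Sum>n\<in>S. \<delta> n) \<le> 2 * J * \<delta> k"
    if "finite S" "1 \<le> k" "\<forall>n\<in>S. k \<le> n" "\<forall>m\<in>S. \<forall>n\<in>S. m < n \<longrightarrow> \<epsilon> * real m \<le> real n - real m" for S k
    using that
  proof (induction "card S" arbitrary: S k rule: less_induct)
    case less
    show ?case
    proof (cases "S = {}")
      case True
      then show ?thesis using J pos[of k] by simp
    next
      case False
      \<comment> \<open>Starting the window at the minimum, with \<open>2 \<le> N\<close>, puts an
        element of \<open>S\<close> into it, so the remainder is smaller.\<close>
      define k' where "k' = Min S"
      have k': "k' \<in> S" "\<And>n. n \<in> S \<Longrightarrow> k' \<le> n" using False less.prems(1) by (auto simp: k'_def)
      have "1 \<le> k'" "k \<le> k'" using k' less.prems by auto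
      define A where "A = {n\<in>S. n < N * k'}"
      define A' where "A' = {n\<in>S. N * k' \<le> n}"
      have fin: "finite A" "finite A'" using less.prems(1) by (auto simp: A_def A'_def)
      have S: "S = A \<union> A'" "A \<inter> A' = {}" by (auto simp: A_def A'_def)
      have k'A: "k' \<in> A" using k' N \<open>1 \<le> k'\<close> by (simp add: A_def)
      have "card A \<le> nat \<lfloor>real (N * k') / (\<epsilon> * real k')\<rfloor> + 1"
      proof (rule card_separated)
        fix m n assume mn: "m \<in> A" "n \<in> A" "m < n"
        then have "\<epsilon> * real k' \<le> \<epsilon> * real m" using k' \<epsilon> by (intro mult_left_mono) (auto simp: A_def)
        also have "\<dots> \<le> real n - real m" using less.prems(4) mn by (auto simp: A_def)
        finally show "\<epsilon> * real k' \<le> real n - real m" .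
      qed (use \<epsilon> \<open>1 \<le> k'\<close> in \<open>auto simp: A_def simp flip: of_nat_mult\<close>)
      also have "real (N * k') / (\<epsilon> * real k') = real N / \<epsilon>" using \<open>1 \<le> k'\<close> by simp
      finally have card: "real (card A) \<le> J" unfolding J_def by (rule of_nat_mono)
      have "(\<Sum>n\<in>A. \<delta> n) \<le> real (card A) * \<delta> k'"
        by (rule sum_bounded_above) (use mono k' in \<open>simp add: A_def\<close>)
      also have "\<dots> \<le> J * \<delta> k'" using card pos[of k'] by (intro mult_right_mono) auto
      finally have 1: "(\<Sum>n\<in>A. \<delta> n) \<le> J * \<delta> k'" .
      have "A' \<subset> S" using S k'A by blast
      then have "card A' < card S" by (rule psubset_card_mono[OF less.prems(1)])
      then have "(\<Sum>n\<in>A'. \<delta> n) \<le> 2 * J * \<delta> (N * k')"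
      proof (rule less.hyps)
        show "1 \<le> N * k'" using N \<open>1 \<le> k'\<close> by simp
        show "\<forall>n\<in>A'. N * k' \<le> n" by (simp add: A'_def)
        show "\<forall>m\<in>A'. \<forall>n\<in>A'. m < n \<longrightarrow> \<epsilon> * real m \<le> real n - real m"
          using less.prems(4) by (simp add: A'_def)
      qed (rule fin)
      also have "\<dots> \<le> 2 * J * (\<delta> k' / 2)" using half[OF \<open>1 \<le> k'\<close>] J by (intro mult_left_mono) auto
      finally have 2: "(\<Sum>n\<in>A'. \<delta> n) \<le> J * \<delta> k'" by simp
      have "(\<Sum>n\<in>S. \<delta> n) = (\<Sum>n\<in>A. \<delta> n) + (\<Sum>n\<in>A'. \<delta> n)"
        unfolding S(1) by (rule sum.union_disjoint[OF fin S(2)])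
      also have "\<dots> \<le> 2 * J * \<delta> k'" using 1 2 by simp
      also have "\<dots> \<le> 2 * J * \<delta> k" using mono[OF \<open>k \<le> k'\<close>] J by (intro mult_left_mono) auto
      finally show ?thesis .
    qed
  qed
  then show ?thesis by (intro exI[of _ "2 * J"] allI impI) simp
qed

lemma right_special_sum_le_spectral_dist_sup:
  fixes \<delta> :: "nat \<Rightarrow> real"
  assumes \<theta>: "0 < \<theta>" "\<theta> < 1"
    and pos: "\<And>n. 0 < \<delta> n" and dec: "\<And>m n. m < n \<Longrightarrow> \<delta> n < \<delta> m"
    and x: "x \<in> sturmian_subshift \<theta>" and y: "y \<in> sturmian_subshift \<theta>" and "x \<noteq> y"
    and S: "finite S" "\<And>n. n \<in> S \<Longrightarrow> common_prefix_length x y \<le> n"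
      "\<And>n. n \<in> S \<Longrightarrow> right_special (sturmian_language \<theta>) (map x [0..<n])"
  shows "ennreal (\<Sum>n\<in>S. \<delta> n) \<le> spectral_dist_sup \<theta> \<delta> x y"
proof -
  note L = extensible_sturmian_language[OF \<theta>]
  obtain c f where c: "c \<in> choice_functions (sturmian_language \<theta>)"
    and f: "f \<in> continuous_functions \<delta> (sturmian_subshift \<theta>)"
      "commutator_norm_le_1 \<delta> (edges (sturmian_language \<theta>)) c f" "cmod (f x - f y) = (\<Sum>n\<in>S. \<delta> n)"
    using spectral_lower_bound[where \<delta> = \<delta> and S = S, OF L pos dec _ _ \<open>x \<noteq> y\<close> S] x y
    unfolding language_shift_sturmian by blast
  have "ennreal (\<Sum>n\<in>S. \<delta> n) \<le> spectral_dist \<theta> \<delta> c x y"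
    unfolding spectral_dist_def f(3)[symmetric] using f by (intro SUP_upper) auto
  also have "\<dots> \<le> spectral_dist_sup \<theta> \<delta> x y"
    unfolding spectral_dist_sup_def using c by (intro SUP_upper)
  finally show ?thesis .
qed

lemma lipschitz_of_badly_approximable:
  fixes \<theta> c2 :: real and \<delta> :: "nat \<Rightarrow> real"
  assumes \<theta>: "0 < \<theta>" "\<theta> < 1" and badly: "badly_approximable (\<theta> / (1 + \<theta>))"
    and pos: "\<And>n. 0 < \<delta> n" and dec: "\<And>m n. m < n \<Longrightarrow> \<delta> n < \<delta> m" and lim: "\<delta> \<longlonglongrightarrow> 0"
    and c2: "0 < c2" "\<And>n m. n \<ge> 1 \<Longrightarrow> m \<ge> 1 \<Longrightarrow> \<delta> (n * m) \<le> c2 * \<delta> n * \<delta> m"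
  shows "lipschitz_equivalent (sturmian_subshift \<theta>) (spectral_dist_sup \<theta> \<delta>) (word_dist \<delta>)"
proof -
  let ?\<alpha> = "\<theta> / (1 + \<theta>)" and ?L = "sturmian_language \<theta>"
  have \<alpha>: "0 < ?\<alpha>" "?\<alpha> < 1" using \<theta> by auto
  note L = extensible_sturmian_language[OF \<theta>]
  obtain c where "badly_approximable_rotation ?\<alpha> c"
    using badly_approximable_rotationI[OF \<alpha> badly] by blast
  then interpret badly_approximable_rotation ?\<alpha> c .
  have "0 < c\<^sup>2 / 3" using c by simp
  from lacunary_sum_bound[OF pos dec lim c2 this] obtain B where B: "\<And>k S. 1 \<le> k \<Longrightarrow> finite S \<Longrightarrow> \<forall>n\<in>S. k \<le> n \<Longrightarrow>
      \<forall>m\<in>S. \<forall>n\<in>S. m < n \<longrightarrow> c\<^sup>2 / 3 * real m \<le> real n - real m \<Longrightarrow> (\<Sum>n\<in>S. \<delta> n) \<le> B * \<delta> k"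
    by blast
  have bound: "(\<Sum>j | k \<le> j \<and> j < n \<and> right_special ?L (map z [0..<j]). \<delta> j) \<le> B * \<delta> k" if "1 \<le> k" for z k n
  proof (rule B[OF that])
    show "finite {j. k \<le> j \<and> j < n \<and> right_special ?L (map z [0..<j])}"
      by (rule finite_subset[of _ "{..<n}"]) auto
  qed (use right_special_prefix_gap[OF \<theta> refl] that in auto)
  have "0 \<le> B * \<delta> 1" using B[of 1 "{}"] by simp
  then have B0: "0 \<le> B" using pos[of 1] by (simp add: zero_le_mult_iff)
  show ?thesis unfolding lipschitz_equivalent_def
  proof (intro exI[of _ "2 * B + 1"] conjI ballI)
    show "0 < 2 * B + 1" using B0 by simp
    fix x y assume x: "x \<in> sturmian_subshift \<theta>" and y: "y \<in> sturmian_subshift \<theta>"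
    show "ennreal (inverse (2 * B + 1) * word_dist \<delta> x y) \<le> spectral_dist_sup \<theta> \<delta> x y"
    proof (cases "x = y")
      case True
      then show ?thesis by (simp add: word_dist_def)
    next
      case False
      let ?m = "common_prefix_length x y"
      note m = common_prefix_length_props[OF False]
      \<comment> \<open>The common prefix is itself right special because \<open>x\<close> and
        \<open>y\<close> continue it differently; this single jump gives the lower bound.\<close>
      have "map x [0..<?m] @ [x ?m] = map x [0..<Suc ?m]" by simp
      moreover have "map x [0..<?m] @ [y ?m] = map y [0..<Suc ?m]" using m by simp
      ultimately have "right_special ?L (map x [0..<?m])"
        using shift_prefix_in_language[of x ?L] shift_prefix_in_language[of y ?L] x y m(2)
        unfolding language_shift_sturmian by (metis right_specialI)
      then have "ennreal (\<Sum>n\<in>{?m}. \<delta> n) \<le> spectral_dist_sup \<theta> \<delta> x y"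
        by (intro right_special_sum_le_spectral_dist_sup[OF \<theta> pos dec x y False]) auto
      moreover have "inverse (2 * B + 1) * word_dist \<delta> x y \<le> 1 * word_dist \<delta> x y"
        using B0 pos[of ?m] by (intro mult_right_mono) (auto simp: word_dist_def field_simps)
      ultimately show ?thesis using False by (simp add: word_dist_def) (meson ennreal_leI order_trans)
    qed
    show "spectral_dist_sup \<theta> \<delta> x y \<le> ennreal ((2 * B + 1) * word_dist \<delta> x y)"
      unfolding spectral_dist_sup_def spectral_dist_def
    proof (intro SUP_least ennreal_leI, clarify)
      fix c f
      assume *: "c \<in> choice_functions ?L" "f \<in> continuous_functions \<delta> (sturmian_subshift \<theta>)"
        "commutator_norm_le_1 \<delta> (edges ?L) c f"
      show "cmod (f x - f y) \<le> (2 * B + 1) * word_dist \<delta> x y"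
      proof (cases "x = y")
        case True
        then show ?thesis by (simp add: word_dist_def)
      next
        case False
        then show ?thesis
          using spectral_upper_bound[OF L *(1) pos dec lim _ *(3) _ _ False bound] *(2) x y
          unfolding language_shift_sturmian by simp
      qed
    qed
  qed
qed

section \<open>Long periodic runs and failure of Lipschitz equivalence\<close>

lemma rot_code_in_subshift:
  assumes "0 < \<theta>" "\<theta> < 1"
  shows "rot_code (\<theta> / (1 + \<theta>)) y \<in> sturmian_subshift \<theta>"
proof -
  let ?\<alpha> = "\<theta> / (1 + \<theta>)"
  have "map (rot_code ?\<alpha> y) [i..<i + n] = rot_word ?\<alpha> (y + real i * ?\<alpha>) n" for i n
    by (rule nth_equalityI) (auto simp: rot_code_shift simp del: times_divide_eq_right)
  then show ?thesis using rot_word_in_language[OF assms] by (auto simp: sturmian_subshift_def)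
qed

text \<open>If a run of period \<open>q\<close> in \<open>x\<close> stops at the letter with index \<open>N + q\<close>, then every prefix of \<open>x\<close> of
  length \<open>N - t * q\<close> occurs in \<open>x\<close> a second time, ending where the run stops.\<close>

lemma right_special_in_periodic_run:
  assumes x: "x \<in> language_shift L" and per: "\<And>i. i < N \<Longrightarrow> x (i + q) = x i"
    and stop: "x (N + q) \<noteq> x N" and t: "t * q \<le> N"
  shows "right_special L (map x [0..<N - t * q])"
proof -
  let ?n = "N - t * q"
  have run: "x (i + s * q) = x i" if "i + s * q < N + q" for i s
    using that
  proof (induction s)
    case (Suc s)
    then show ?case using per[of "i + s * q"] by (simp add: algebra_simps)
  qed simp
  \<comment> \<open>A shift by \<open>t + 1\<close> periods moves the index \<open>N - t * q\<close>
    just after the prefix to \<open>N + q\<close>, the first place where the run fails.\<close>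
  have "map x [Suc t * q..<Suc t * q + Suc ?n] = map x [0..<?n] @ [x (N + q)]"
  proof (rule nth_equalityI)
    fix i assume "i < length (map x [Suc t * q..<Suc t * q + Suc ?n])"
    then have i: "i \<le> ?n" by simp
    show "map x [Suc t * q..<Suc t * q + Suc ?n] ! i = (map x [0..<?n] @ [x (N + q)]) ! i"
    proof (cases "i = ?n")
      case True
      then show ?thesis using t by (simp add: nth_append algebra_simps)
    next
      case False
      then have "i < ?n" using i by simp
      then have "i < ?n" and "x (i + Suc t * q) = x i" using t by (simp, intro run) simp
      moreover from this t have "i < length [Suc t * q..<Suc t * q + Suc ?n]" by simp
      ultimately show ?thesis by (simp only: nth_map nth_upt nth_append length_map) (simp add: add.commute)
    qed
  qed simp
  moreover have "map x [0..<Suc ?n] = map x [0..<?n] @ [x N]"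
    using run[of ?n t] t stop by (cases "q = 0") auto
  ultimately show ?thesis
    using x stop shift_prefix_in_language[OF x, of "Suc ?n"]
    unfolding language_shift_def mem_Collect_eq
    by (intro right_specialI[where a = "x N" and b = "x (N + q)"]) (simp only:, metis, simp)
qed

lemma badly_approximable_of_lipschitz:
  fixes \<theta> c1 :: real and \<delta> :: "nat \<Rightarrow> real"
  assumes \<theta>: "0 < \<theta>" "\<theta> < 1" "\<theta> \<notin> \<rat>"
    and pos: "\<And>n. 0 < \<delta> n" and dec: "\<And>m n. m < n \<Longrightarrow> \<delta> n < \<delta> m"
    and c1: "c1 > 0" "\<And>n. n \<ge> 1 \<Longrightarrow> c1 * \<delta> n \<le> \<delta> (2 * n)"
    and lip: "lipschitz_equivalent (sturmian_subshift \<theta>) (spectral_dist_sup \<theta> \<delta>) (word_dist \<delta>)"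
  shows "badly_approximable (\<theta> / (1 + \<theta>))"
proof (rule ccontr)
  let ?\<alpha> = "\<theta> / (1 + \<theta>)" and ?L = "sturmian_language \<theta>"
  have \<alpha>: "0 < ?\<alpha>" "?\<alpha> < 1" "?\<alpha> \<notin> \<rat>" using \<theta> irrational_rotation_number by auto
  note L = extensible_sturmian_language[OF \<theta>(1,2)]
  assume nba: "\<not> badly_approximable ?\<alpha>"
  obtain c where c: "c > 0" and le: "\<And>x y. x \<in> sturmian_subshift \<theta> \<Longrightarrow> y \<in> sturmian_subshift \<theta> \<Longrightarrow>
      spectral_dist_sup \<theta> \<delta> x y \<le> ennreal (c * word_dist \<delta> x y)"
    using lip unfolding lipschitz_equivalent_def by blast
  obtain K :: nat where K: "c / c1 < real K" using reals_Archimedean2 by blast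
  have "0 < c / c1" using c c1 by simp
  then have K1: "1 \<le> K" using K by linarith
  \<comment> \<open>The run is twice as long as the \<open>K\<close> periods to be used, so that
    \<open>N \<le> 2 * m\<close> below and the doubling bound on \<delta> applies once.\<close>
  obtain q z where q: "1 \<le> q" and per: "\<And>i. i < (2 * K) * q \<Longrightarrow> rot_code ?\<alpha> z (i + q) = rot_code ?\<alpha> z i"
    using long_powers[OF nba, of "2 * K"] by blast
  define x where "x = rot_code ?\<alpha> z"
  \<comment> \<open>The run may outlast the guaranteed length; right special prefixes are counted
    back from its actual end.\<close>
  define N where "N = (LEAST i. x (i + q) \<noteq> x i)"
  have stop: "x (N + q) \<noteq> x N"
    unfolding N_def x_def by (rule LeastI_ex) (rule rot_code_aperiodic[OF \<alpha> q])
  have run: "x (i + q) = x i" if "i < N" for i using not_less_Least[OF that[unfolded N_def]] by blast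
  have "2 * K * q \<le> N" using per stop unfolding x_def by (meson not_le_imp_less)
  then have NK: "2 * (K * q) \<le> N" by (simp only: mult.assoc)
  define m where "m = N - K * q"
  have "1 \<le> K * q" using mult_le_mono[OF K1 q] by simp
  then have m: "N \<le> 2 * m" "1 \<le> m" using NK unfolding m_def by linarith+
  have tq: "t * q \<le> K * q" if "t \<le> K" for t using that by (rule mult_le_mono1)
  have x: "x \<in> sturmian_subshift \<theta>" unfolding x_def by (rule rot_code_in_subshift[OF \<theta>(1,2)])
  have rs: "right_special ?L (map x [0..<N - t * q])" if "t \<le> K" for t
  proof (rule right_special_in_periodic_run[OF _ run stop])
    show "x \<in> language_shift ?L" using x by (simp add: language_shift_sturmian)
    show "t * q \<le> N" using tq[OF that] NK by linarith
  qed
  \<comment> \<open>The second sequence leaves \<open>x\<close> at length \<open>m\<close>, the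
    shortest of the \<open>K\<close> right special lengths, so all of them contribute jumps.\<close>
  obtain e where e: "e \<noteq> x m" by (metis letter.distinct(1))
  have we: "map x [0..<m] @ [e] \<in> ?L"
    using rs[of K] unfolding m_def[symmetric] right_special_def by (cases e) auto
  \<comment> \<open>Overriding on the empty set yields an arbitrary choice function.\<close>
  obtain ch where ch: "ch \<in> choice_functions ?L" using choice_functions_override[OF L, of "{}"] by blast
  define y where "y = choice_seq ch (map x [0..<m] @ [e])"
  have y: "y \<in> sturmian_subshift \<theta>"
    unfolding y_def using choice_seq_in_shift[OF L ch we] by (simp add: language_shift_sturmian)
  have "y i = (map x [0..<m] @ [e]) ! i" if "i \<le> m" for i
    unfolding y_def using that by (intro choice_seq_prefix) simp
  then have yi: "\<And>i. i < m \<Longrightarrow> y i = x i" and ym: "y m = e" by (simp_all add: nth_append)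
  have cpl: "common_prefix_length x y = m"
    by (rule common_prefix_length_eqI) (use yi ym e in auto)
  have "x \<noteq> y" using ym e by auto
  define S where "S = (\<lambda>t. N - t * q) ` {1..K}"
  have S_bounds: "m \<le> n \<and> n \<le> 2 * m" if nS: "n \<in> S" for n
  proof -
    obtain t where "t \<in> {1..K}" and n: "n = N - t * q" using nS unfolding S_def by blast
    then have "t * q \<le> K * q" by (intro tq) simp
    then show ?thesis using m(1) unfolding m_def n by linarith
  qed
  have "inj_on (\<lambda>t. N - t * q) {1..K}"
  proof (rule inj_onI)
    fix s t assume st: "s \<in> {1..K}" "t \<in> {1..K}" "N - s * q = N - t * q"
    then have "s * q \<le> K * q" "t * q \<le> K * q" by (auto intro!: tq)
    then have "s * q = t * q" using st(3) NK by linarith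
    then show "s = t" using q by simp
  qed
  then have "card S = K" unfolding S_def by (simp add: card_image)
  have "ennreal (\<Sum>n\<in>S. \<delta> n) \<le> spectral_dist_sup \<theta> \<delta> x y"
  proof (rule right_special_sum_le_spectral_dist_sup[OF \<theta>(1,2) pos dec x y \<open>x \<noteq> y\<close>])
    show "finite S" by (simp add: S_def)
    show "common_prefix_length x y \<le> n" if "n \<in> S" for n using S_bounds[OF that] cpl by simp
    show "right_special ?L (map x [0..<n])" if "n \<in> S" for n using that rs by (auto simp: S_def)
  qed
  also have "\<dots> \<le> ennreal (c * word_dist \<delta> x y)" by (rule le[OF x y])
  also have "word_dist \<delta> x y = \<delta> m" using \<open>x \<noteq> y\<close> cpl by (simp add: word_dist_def)
  finally have "(\<Sum>n\<in>S. \<delta> n) \<le> c * \<delta> m" using c pos[of m] by (simp add: ennreal_le_iff)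
  moreover have "real K * (c1 * \<delta> m) \<le> (\<Sum>n\<in>S. \<delta> n)"
  proof -
    have "c1 * \<delta> m \<le> \<delta> n" if "n \<in> S" for n
    proof -
      have "\<delta> (2 * m) \<le> \<delta> n" using S_bounds[OF that] dec[of n "2 * m"] by (cases "n = 2 * m") auto
      then show ?thesis using c1(2)[OF m(2)] by linarith
    qed
    then show ?thesis using sum_bounded_below[of S "c1 * \<delta> m" \<delta>] \<open>card S = K\<close> by simp
  qed
  ultimately have "(real K * c1) * \<delta> m \<le> c * \<delta> m" by simp
  then have "real K * c1 \<le> c" using pos[of m] by simp
  then show False using K c1(1) by (simp add: field_simps)
qed

theorem corollary4p13:
  fixes \<theta> c1 c2 :: real and \<delta> :: "nat \<Rightarrow> real"
  assumes "0 < \<theta>" and "\<theta> < 1" and "\<theta> \<notin> \<rat>"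
    and "\<And>n. 0 < \<delta> n"
    and "\<And>m n. m < n \<Longrightarrow> \<delta> n < \<delta> m"
    and "\<delta> \<longlonglongrightarrow> 0"
    and "c1 > 0" and "\<And>n. n \<ge> 1 \<Longrightarrow> c1 * \<delta> n \<le> \<delta> (2 * n)"
    and "c2 > 0" and "\<And>n m. n \<ge> 1 \<Longrightarrow> m \<ge> 1 \<Longrightarrow> \<delta> (n * m) \<le> c2 * \<delta> n * \<delta> m"
  shows "(linearly_recurrent (sturmian_language \<theta>) \<longleftrightarrow> bounded_partial_quotients \<theta>) \<and>
         (bounded_partial_quotients \<theta> \<longleftrightarrow>
            lipschitz_equivalent (sturmian_subshift \<theta>) (spectral_dist_sup \<theta> \<delta>) (word_dist \<delta>))"
  unfolding bounded_partial_quotients_iff_badly_approximable[OF assms(1-3)]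
    linearly_recurrent_iff_badly_approximable[OF assms(1-3)]
  using lipschitz_of_badly_approximable[where \<delta> = \<delta>, OF assms(1,2) _ assms(4-6) assms(9,10)]
    badly_approximable_of_lipschitz[where \<delta> = \<delta>, OF assms(1-5) assms(7,8)]
  by blast

end
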